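(* Let $\varphi\in\mathfrak{G}_0$ be such that $\varphi(\mathbb{C}_0)\subset D\subset\mathbb{C}_{1/2}$, where $D$ is a simply connected domain. Let $R_D$ be a Riemann map from the unit disk $\mathbb{D}$ onto $D$ such that $R_D(0)=\varphi(+\infty)$, and let $\varphi_D(s)=R_D(2^{-s})$. If $C_{\varphi_D}$ is compact on $\mathcal{H}^2$, then $C_\varphi$ is compact on $\mathcal{H}^2$. Moreover, if $D\subset\{s:|\Im s|\le C\}$ for some $C>0$ and if $C_{\varphi_D}$ belongs to $S_{2p}$ for some $p\ge1$, then $C_\varphi$ belongs to $S_{2p}$.
   Context: For $\theta\in\mathbb{R}$, $\mathbb{C}_\theta=\{s\in\mathbb{C}:\Re s>\theta\}$. $\mathcal{H}^2$ is the Hilbert space of Dirichlet series $f(s)=\sum_{n\ge1}a_n n^{-s}$ with $\|f\|^2_{\mathcal{H}^2}=\sum_{n\ge1}|a_n|^2<\infty$ (such $f$ are holomorphic in $\mathbb{C}_{1/2}$). $\mathfrak{G}_0$ is the class of (somewhere convergent) Dirichlet series $\varphi(s)=\sum_{n\ge1}c_n n^{-s}$ that define a holomorphic function on $\mathbb{C}_0$ with $\varphi(\mathbb{C}_0)\subset\mathbb{C}_{1/2}$; for such $\varphi$, $C_\varphi f=f\circ\varphi$ is a bounded operator on $\mathcal{H}^2$. $\varphi(+\infty)=c_1$ is the first coefficient of $\varphi$. For $p>0$, $S_p$ is the Schatten class of compact operators on $\mathcal{H}^2$ whose singular value sequence $(s_n)$ satisfies $\sum_n s_n^p<\infty$. 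*)

theory Defs
  imports "HOL-Complex_Analysis.Complex_Analysis"
begin

section \<open>The Hilbert space of Dirichlet series\<close>

text \<open>
  An element is the coefficient sequence \<open>(a\<^sub>n)\<close> of \<open>\<Sum>n\<ge>1. a\<^sub>n n\<^sup>-\<^sup>s\<close>; the unused
  entry at index \<open>0\<close> is normalised to \<open>0\<close>, so that the representation is unique.
\<close>

typedef h2 = "{a :: nat \<Rightarrow> complex. a 0 = 0 \<and> summable (\<lambda>n. (cmod (a n))\<^sup>2)}"
  morphisms coeff_h2 Abs_h2
  by (rule exI[of _ "\<lambda>_. 0"]) simp

setup_lifting type_definition_h2

lemma summable_cmod_square_add:
  assumes "summable (\<lambda>n. (cmod (a n))\<^sup>2)" "summable (\<lambda>n. (cmod (b n))\<^sup>2)"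
  shows "summable (\<lambda>n. (cmod (a n + b n))\<^sup>2)"
proof (rule summable_comparison_test_ev[OF always_eventually])
  show "\<forall>n. norm ((cmod (a n + b n))\<^sup>2) \<le> 2 * (cmod (a n))\<^sup>2 + 2 * (cmod (b n))\<^sup>2"
  proof
    fix n
    have "(cmod (a n + b n))\<^sup>2 \<le> (cmod (a n) + cmod (b n))\<^sup>2"
      by (intro power_mono norm_triangle_ineq) simp
    also have "\<dots> \<le> 2 * (cmod (a n))\<^sup>2 + 2 * (cmod (b n))\<^sup>2"
      using zero_le_power2[of "cmod (a n) - cmod (b n)"]
      by (simp add: power2_eq_square algebra_simps)
    finally show "norm ((cmod (a n + b n))\<^sup>2) \<le> 2 * (cmod (a n))\<^sup>2 + 2 * (cmod (b n))\<^sup>2"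
      by simp
  qed
  show "summable (\<lambda>n. 2 * (cmod (a n))\<^sup>2 + 2 * (cmod (b n))\<^sup>2)"
    by (intro summable_add summable_mult assms)
qed

lemma summable_cmod_square_scale:
  assumes "summable (\<lambda>n. (cmod (a n))\<^sup>2)"
  shows "summable (\<lambda>n. (cmod (c * a n))\<^sup>2)"
  using summable_mult[OF assms, of "(cmod c)\<^sup>2"] by (simp add: norm_mult power_mult_distrib)

instantiation h2 :: real_vector
begin

lift_definition zero_h2 :: h2 is "\<lambda>_. 0" by simp
lift_definition plus_h2 :: "h2 \<Rightarrow> h2 \<Rightarrow> h2" is "\<lambda>a b n. a n + b n"
  by (simp add: summable_cmod_square_add)
lift_definition uminus_h2 :: "h2 \<Rightarrow> h2" is "\<lambda>a n. - a n" by simp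
lift_definition minus_h2 :: "h2 \<Rightarrow> h2 \<Rightarrow> h2" is "\<lambda>a b n. a n - b n"
  subgoal for a b using summable_cmod_square_add[of a "\<lambda>n. - b n"] by simp
  done
lift_definition scaleR_h2 :: "real \<Rightarrow> h2 \<Rightarrow> h2" is "\<lambda>r a n. complex_of_real r * a n"
  by (simp add: summable_cmod_square_scale del: norm_mult)

instance
  by standard (transfer; simp add: fun_eq_iff algebra_simps)+

end

lift_definition scaleC_h2 :: "complex \<Rightarrow> h2 \<Rightarrow> h2" is "\<lambda>c a n. c * a n"
  by (simp add: summable_cmod_square_scale del: norm_mult)

interpretation complex_h2: vector_space scaleC_h2
  by standard (transfer; simp add: fun_eq_iff algebra_simps)+

definition cinner_h2 :: "h2 \<Rightarrow> h2 \<Rightarrow> complex" where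
  "cinner_h2 f g = (\<Sum>n. coeff_h2 f n * cnj (coeff_h2 g n))"

lemma summable_coeff_h2: "summable (\<lambda>n. (cmod (coeff_h2 f n))\<^sup>2)"
  using coeff_h2[of f] by simp

lemma summable_cinner_h2: "summable (\<lambda>n. coeff_h2 f n * cnj (coeff_h2 g n))"
proof (rule summable_comparison_test_ev[OF always_eventually])
  show "\<forall>n. cmod (coeff_h2 f n * cnj (coeff_h2 g n))
          \<le> (cmod (coeff_h2 f n))\<^sup>2 + (cmod (coeff_h2 g n))\<^sup>2"
  proof
    fix n
    have "0 \<le> (cmod (coeff_h2 f n) - cmod (coeff_h2 g n))\<^sup>2"
      and "0 \<le> (cmod (coeff_h2 f n))\<^sup>2 + (cmod (coeff_h2 g n))\<^sup>2" by simp_all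
    then show "cmod (coeff_h2 f n * cnj (coeff_h2 g n))
          \<le> (cmod (coeff_h2 f n))\<^sup>2 + (cmod (coeff_h2 g n))\<^sup>2"
      unfolding norm_mult complex_mod_cnj power2_diff by linarith
  qed
  show "summable (\<lambda>n. (cmod (coeff_h2 f n))\<^sup>2 + (cmod (coeff_h2 g n))\<^sup>2)"
    by (intro summable_add summable_coeff_h2)
qed

text \<open>Norm and topology come from the complex inner product; its real part is the inner product
  of the class \<open>real_inner\<close>.\<close>

instantiation h2 :: real_inner
begin

definition inner_h2 :: "h2 \<Rightarrow> h2 \<Rightarrow> real" where
  "inner_h2 f g = Re (cinner_h2 f g)"
definition norm_h2 :: "h2 \<Rightarrow> real" where
  "norm_h2 f = sqrt (\<Sum>n. (cmod (coeff_h2 f n))\<^sup>2)"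
definition dist_h2 :: "h2 \<Rightarrow> h2 \<Rightarrow> real" where
  "dist_h2 f g = norm (f - g)"
definition sgn_h2 :: "h2 \<Rightarrow> h2" where
  "sgn_h2 f = f /\<^sub>R norm f"
definition uniformity_h2 :: "(h2 \<times> h2) filter" where
  "uniformity_h2 = (INF e\<in>{0<..}. principal {(f, g). dist f g < e})"
definition open_h2 :: "h2 set \<Rightarrow> bool" where
  "open_h2 U = (\<forall>f\<in>U. eventually (\<lambda>(f', g). f' = f \<longrightarrow> g \<in> U) uniformity)"

instance
proof
  fix f g h :: h2 and r :: real and U :: "h2 set"
  have inner: "f \<bullet> g = (\<Sum>n. Re (coeff_h2 f n * cnj (coeff_h2 g n)))" for f g :: h2
    unfolding inner_h2_def cinner_h2_def by (rule Re_suminf[OF summable_cinner_h2])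
  have summ: "summable (\<lambda>n. Re (coeff_h2 f n * cnj (coeff_h2 g n)))" for f g
    by (rule summable_Re[OF summable_cinner_h2])
  have self: "f \<bullet> f = (\<Sum>n. (cmod (coeff_h2 f n))\<^sup>2)" for f :: h2
    unfolding inner cmod_power2 by (simp add: power2_eq_square)
  show "dist f g = norm (f - g)" by (rule dist_h2_def)
  show "sgn f = f /\<^sub>R norm f" by (rule sgn_h2_def)
  show "uniformity = (INF e\<in>{0<..}. principal {(f :: h2, g). dist f g < e})"
    by (rule uniformity_h2_def)
  show "open U = (\<forall>f\<in>U. eventually (\<lambda>(f', g). f' = f \<longrightarrow> g \<in> U) uniformity)"
    by (rule open_h2_def)
  show "f \<bullet> g = g \<bullet> f" unfolding inner by (simp add: mult.commute)
  show "(f + g) \<bullet> h = f \<bullet> h + g \<bullet> h"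
    unfolding inner suminf_add[OF summ summ] by (simp add: plus_h2.rep_eq algebra_simps)
  show "(r *\<^sub>R f) \<bullet> g = r * (f \<bullet> g)"
    unfolding inner suminf_mult[OF summ, symmetric]
    by (simp add: scaleR_h2.rep_eq algebra_simps)
  show "0 \<le> f \<bullet> f" unfolding self by (intro suminf_nonneg summable_coeff_h2) simp
  show "f \<bullet> f = 0 \<longleftrightarrow> f = 0"
    unfolding self suminf_eq_zero_iff[OF summable_coeff_h2 zero_le_power2]
    by (simp add: coeff_h2_inject[symmetric] zero_h2.rep_eq fun_eq_iff)
  show "norm f = sqrt (f \<bullet> f)" unfolding self by (rule norm_h2_def)
qed

end


section \<open>Dirichlet series and composition operators\<close>

abbreviation half_plane :: "real \<Rightarrow> complex set" where
  "half_plane \<theta> \<equiv> {s. \<theta> < Re s}"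

text \<open>All series below may be summed from \<open>n = 0\<close>: the term at \<open>n = 0\<close> vanishes because
  \<open>0 powr (- s) = 0\<close>.\<close>

definition eval_h2 :: "h2 \<Rightarrow> complex \<Rightarrow> complex" where
  "eval_h2 f s = (\<Sum>n. coeff_h2 f n * of_nat n powr (- s))"

definition has_dirichlet_series :: "(complex \<Rightarrow> complex) \<Rightarrow> (nat \<Rightarrow> complex) \<Rightarrow> bool" where
  "has_dirichlet_series \<phi> c \<longleftrightarrow>
     (\<exists>\<sigma>. \<forall>s\<in>half_plane \<sigma>. (\<lambda>n. c n * of_nat n powr (- s)) sums \<phi> s)"

text \<open>The Gordon--Hedenmalm class of symbols with characteristic zero. Only the values of
  \<open>\<phi>\<close> on \<open>half_plane 0\<close> are relevant; the series need not converge in all of it.\<close>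

definition GH0 :: "(complex \<Rightarrow> complex) set" where
  "GH0 = {\<phi>. \<phi> holomorphic_on half_plane 0 \<and> \<phi> ` half_plane 0 \<subseteq> half_plane (1/2) \<and>
             (\<exists>c. has_dirichlet_series \<phi> c)}"

text \<open>\<open>f \<circ> \<phi>\<close> as an element of the space: the series representing it on the half-plane on which
  all elements of the space converge.\<close>

definition comp_op :: "(complex \<Rightarrow> complex) \<Rightarrow> h2 \<Rightarrow> h2" where
  "comp_op \<phi> f = (THE g. \<forall>s\<in>half_plane (1/2). eval_h2 g s = eval_h2 f (\<phi> s))"


section \<open>Compact operators and Schatten classes\<close>

definition compact_op :: "(h2 \<Rightarrow> h2) \<Rightarrow> bool" where
  "compact_op T \<longleftrightarrow>
     Vector_Spaces.linear scaleC_h2 scaleC_h2 T \<and> compact (closure (T ` cball 0 1))"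

definition cadjoint_h2 :: "(h2 \<Rightarrow> h2) \<Rightarrow> h2 \<Rightarrow> h2" where
  "cadjoint_h2 T = (THE S. \<forall>f g. cinner_h2 (T f) g = cinner_h2 f (S g))"

text \<open>The singular values of a compact operator \<open>T\<close> are the square roots of the eigenvalues of
  \<open>T\<^sup>* T\<close>, in decreasing order, each positive one repeated according to its (complex)
  multiplicity; the sequence is padded with zeros if \<open>T\<close> has finite rank.\<close>

definition singular_value_sequence :: "(h2 \<Rightarrow> h2) \<Rightarrow> (nat \<Rightarrow> real) \<Rightarrow> bool" where
  "singular_value_sequence T \<sigma> \<longleftrightarrow>
     decseq \<sigma> \<and> (\<forall>n. 0 \<le> \<sigma> n) \<and>
     (\<forall>t>0. finite {n. \<sigma> n = t} \<and>
        card {n. \<sigma> n = t} =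
          complex_h2.dim {f. cadjoint_h2 T (T f) = scaleC_h2 (of_real (t\<^sup>2)) f})"

definition schatten :: "real \<Rightarrow> (h2 \<Rightarrow> h2) set" where
  "schatten p = {T. compact_op T \<and>
     (\<exists>\<sigma>. singular_value_sequence T \<sigma> \<and> summable (\<lambda>n. \<sigma> n powr p))}"

end

theory Submission
  imports Defs
begin

text \<open>Both conclusions follow from one factorization \<open>comp_op \<phi> = T \<circ> comp_op \<phi>\<^sub>D\<close> with a linear
contraction \<open>T\<close> of the Hilbert space (\<open>comp_op_factorization\<close>).

Let \<open>G\<close> be the inverse of the Riemann map and \<open>\<psi> = G \<circ> \<phi>\<close>. Then \<open>\<psi>\<close> maps \<open>half_plane 0\<close> into the unit
disk, and since \<open>G\<close> is a power series near \<open>c 1 = R 0\<close> that vanishes there, \<open>\<psi>\<close> is again a Dirichlet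
series, with first coefficient \<open>0\<close> (\<open>abs_dirichlet_holomorphic_image\<close>). For \<open>f\<close> in the space
put \<open>F = f \<circ> R\<close>, a power series \<open>\<Sum>k. a\<^sub>k z\<^sup>k\<close> on the disk. Then \<open>f \<circ> \<phi>\<^sub>D\<close> is \<open>\<Sum>k. a\<^sub>k 2\<^sup>-\<^sup>k\<^sup>s\<close> and \<open>f \<circ> \<phi>\<close> is
\<open>F \<circ> \<psi> = \<Sum>k. a\<^sub>k \<psi>\<^sup>k\<close>. So \<open>T\<close> reads off the coefficients at the powers of \<open>2\<close> and substitutes \<open>\<psi>\<close> for
\<open>2\<^sup>-\<^sup>s\<close>.

That \<open>T\<close> is a contraction is Littlewood's subordination principle (\<open>dirichlet_subordination\<close>): write
\<open>F = F 0 + z F\<^sub>1\<close>; the constant \<open>F 0\<close> is orthogonal to every multiple of \<open>\<psi>\<close>, and multiplication by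
\<open>\<psi>\<close> does not increase the norm, so one passes to \<open>F\<^sub>1\<close> by induction. The norm bound for the
multiplication (\<open>multiplier_contraction\<close>) rests on means along vertical lines. The \<open>n\<close>-th coefficient
of a bounded Dirichlet series \<open>h\<close> is the mean of \<open>h s * n\<^sup>s\<close> on a line far to the right, where the
series converges absolutely; a primitive of \<open>h s * n\<^sup>s\<close> shows that the mean is the same on all
lines \<open>Re s = \<sigma> > 0\<close>. Bessel's inequality on such a line compares the coefficients of \<open>\<psi> g\<close> with
the mean of \<open>\<bar>\<psi> g\<bar>\<^sup>2 \<le> \<bar>g\<bar>\<^sup>2\<close> for a Dirichlet polynomial \<open>g\<close>, and \<open>\<sigma>\<close> tends to \<open>0\<close>.

Compactness passes from \<open>A = comp_op \<phi>\<^sub>D\<close> to \<open>T \<circ> A\<close> because \<open>T\<close> is continuous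
(\<open>compact_op_comp\<close>). The Schatten classes are handled through \<open>\<parallel>T (A f)\<parallel> \<le> \<parallel>A f\<parallel>\<close>: by the
variational description of singular values, \<open>T \<circ> A\<close> has at most as many singular values \<open>\<ge> t\<close> as \<open>A\<close>,
for every \<open>t > 0\<close> (\<open>card_singular_basis_ge_mono\<close>), hence its decreasing sequence of singular values
is dominated termwise (\<open>schatten_dominated\<close>).\<close>

section \<open>Means along vertical lines\<close>

definition has_mean :: "(real \<Rightarrow> complex) \<Rightarrow> complex \<Rightarrow> bool" where
  "has_mean f L \<longleftrightarrow> continuous_on {0..} f \<and>
     ((\<lambda>T. integral {0..T} f / of_real T) \<longlongrightarrow> L) at_top"

lemma has_mean_integrable: "has_mean f L \<Longrightarrow> f integrable_on {0..T}"
  unfolding has_mean_def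
  by (auto intro!: integrable_continuous_interval elim: continuous_on_subset)

lemma has_mean_unique: "has_mean f L \<Longrightarrow> has_mean f M \<Longrightarrow> L = M"
  unfolding has_mean_def using tendsto_unique[OF trivial_limit_at_top_linorder] by blast

lemma has_mean_add:
  assumes "has_mean f L" "has_mean g M"
  shows "has_mean (\<lambda>t. f t + g t) (L + M)"
  using tendsto_add[OF assms(1)[unfolded has_mean_def, THEN conjunct2]
      assms(2)[unfolded has_mean_def, THEN conjunct2]] assms
  unfolding has_mean_def
  by (auto intro!: continuous_intros
      simp: integral_add[OF has_mean_integrable[OF assms(1)] has_mean_integrable[OF assms(2)]]
        add_divide_distrib)

lemma has_mean_cmult:
  assumes "has_mean f L"
  shows "has_mean (\<lambda>t. c * f t) (c * L)"
  using tendsto_mult_left[OF assms(1)[unfolded has_mean_def, THEN conjunct2], of c] assms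
  unfolding has_mean_def by (auto intro!: continuous_intros)

lemma has_mean_zero: "has_mean (\<lambda>t. 0) 0"
  unfolding has_mean_def by simp

lemma has_mean_diff:
  assumes "has_mean f L" "has_mean g M"
  shows "has_mean (\<lambda>t. f t - g t) (L - M)"
  using has_mean_add[OF assms(1) has_mean_cmult[OF assms(2), of "-1"]] by simp

lemma has_mean_sum:
  assumes "finite A" "\<And>i. i \<in> A \<Longrightarrow> has_mean (f i) (L i)"
  shows "has_mean (\<lambda>t. \<Sum>i\<in>A. f i t) (\<Sum>i\<in>A. L i)"
  using assms by (induction A rule: finite_induct) (simp_all add: has_mean_zero has_mean_add)

lemma has_mean_Re_mono:
  assumes f: "has_mean f L" and g: "has_mean g M" and le: "\<And>t. t \<ge> 0 \<Longrightarrow> Re (f t) \<le> Re (g t)"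
  shows "Re L \<le> Re M"
proof (rule tendsto_le[OF trivial_limit_at_top_linorder])
  show "((\<lambda>T. Re (integral {0..T} g / of_real T)) \<longlongrightarrow> Re M) at_top"
    "((\<lambda>T. Re (integral {0..T} f / of_real T)) \<longlongrightarrow> Re L) at_top"
    using f g unfolding has_mean_def by (simp_all only: tendsto_Re)
  have "Re (integral {0..T} f / of_real T) \<le> Re (integral {0..T} g / of_real T)" if "T > 0" for T
  proof -
    have "integral {0..T} (\<lambda>t. Re (f t)) \<le> integral {0..T} (\<lambda>t. Re (g t))"
      by (intro integral_le le integrable_linear[OF has_mean_integrable[OF f] bounded_linear_Re, unfolded o_def]
          integrable_linear[OF has_mean_integrable[OF g] bounded_linear_Re, unfolded o_def]) auto
    then show ?thesis using that
      by (simp add: integral_linear[OF has_mean_integrable[OF f] bounded_linear_Re, unfolded o_def]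
          integral_linear[OF has_mean_integrable[OF g] bounded_linear_Re, unfolded o_def] divide_right_mono)
  qed
  then show "\<forall>\<^sub>F T in at_top. Re (integral {0..T} f / of_real T) \<le> Re (integral {0..T} g / of_real T)"
    using eventually_gt_at_top by (rule eventually_mono[rotated])
qed

text \<open>Means commute with uniform limits, because averaging does not increase the supremum norm. This
transfers the means of Dirichlet polynomials to absolutely convergent series.\<close>

lemma has_mean_uniform_limit:
  assumes F: "\<And>N. has_mean (F N) (L N)" and L: "L \<longlonglongrightarrow> L'"
    and err: "\<And>N t. t \<ge> 0 \<Longrightarrow> norm (f t - F N t) \<le> e N" and e: "e \<longlonglongrightarrow> 0"
  shows "has_mean f L'"
proof -
  have "uniform_limit {0..} F f sequentially"
    unfolding uniform_limit_iff
  proof (intro allI impI)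
    fix r :: real assume "r > 0"
    then have "\<forall>\<^sub>F N in sequentially. e N < r"
      using order_tendstoD(2)[OF e] by blast
    then show "\<forall>\<^sub>F N in sequentially. \<forall>t\<in>{0..}. dist (F N t) (f t) < r"
      by (rule eventually_mono) (metis atLeast_iff dist_commute dist_norm err le_less_trans)
  qed
  then have f: "continuous_on {0..} f"
    using F unfolding has_mean_def by (intro uniform_limit_theorem) auto
  show ?thesis unfolding has_mean_def
  proof (rule conjI[OF f], rule tendstoI)
    fix r :: real assume r: "r > 0"
    have "\<forall>\<^sub>F N in sequentially. dist (e N) 0 < r/3 \<and> dist (L N) L' < r/3"
      using tendstoD[OF e, of "r/3"] tendstoD[OF L, of "r/3"] r by (auto intro: eventually_conj)
    then obtain N where N: "\<bar>e N\<bar> < r/3" "dist (L N) L' < r/3"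
      using eventually_happens[of _ sequentially] by auto
    have fi: "f integrable_on {0..T}" for T
      using f by (auto intro!: integrable_continuous_interval elim: continuous_on_subset)
    have "\<forall>\<^sub>F T in at_top. dist (integral {0..T} (F N) / of_real T) (L N) < r/3"
      using F[of N] r unfolding has_mean_def by (auto dest: tendstoD[where e = "r/3"])
    then show "\<forall>\<^sub>F T in at_top. dist (integral {0..T} f / of_real T) L' < r"
      using eventually_gt_at_top[of 0]
    proof eventually_elim
      case (elim T)
      have "norm (integral {0..T} (\<lambda>t. f t - F N t)) \<le> e N * (T - 0)"
        using elim err[of _ N]
        by (intro integral_bound)
           (auto intro!: continuous_intros continuous_on_subset[OF f]
               continuous_on_subset[OF F[of N, unfolded has_mean_def, THEN conjunct1]])
      then have "norm (integral {0..T} f - integral {0..T} (F N)) \<le> e N * T"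
        by (simp add: integral_diff fi has_mean_integrable[OF F])
      then have "dist (integral {0..T} f / of_real T) (integral {0..T} (F N) / of_real T) \<le> e N"
        using elim by (simp add: dist_norm norm_divide field_simps flip: diff_divide_distrib)
      then show ?case using elim N
          dist_triangle[of "integral {0..T} f / of_real T" L' "integral {0..T} (F N) / of_real T"]
          dist_triangle[of "integral {0..T} (F N) / of_real T" L' "L N"] by linarith
    qed
  qed
qed

lemma has_integral_vertical:
  assumes K: "\<And>s. s \<in> S \<Longrightarrow> (K has_field_derivative k s) (at s)"
    and S: "\<And>t. t \<in> {0..T} \<Longrightarrow> Complex \<sigma> t \<in> S" and T: "0 \<le> T"
  shows "((\<lambda>t. k (Complex \<sigma> t)) has_integral (K (Complex \<sigma> T) - K (Complex \<sigma> 0)) / \<i>) {0..T}"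
proof -
  have "((\<lambda>t. K (Complex \<sigma> t) / \<i>) has_vector_derivative k (Complex \<sigma> t)) (at t within {0..T})"
    if t: "t \<in> {0..T}" for t
  proof -
    have "((\<lambda>t. Complex \<sigma> t) has_vector_derivative \<i>) (at t)"
      unfolding Complex_eq by (auto intro!: derivative_eq_intros)
    from field_vector_diff_chain_at[OF this K[OF S[OF t]]]
    have "((\<lambda>t. K (Complex \<sigma> t)) has_vector_derivative \<i> * k (Complex \<sigma> t)) (at t)"
      by (simp add: o_def)
    from has_vector_derivative_mult_right[OF this, of "1/\<i>"]
    show ?thesis by (simp add: has_vector_derivative_at_within)
  qed
  from fundamental_theorem_of_calculus[OF T this] show ?thesis
    by (simp add: algebra_simps)
qed

lemma continuous_on_vertical:
  assumes "continuous_on (half_plane \<theta>) k" "\<theta> < \<sigma>"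
  shows "continuous_on A (\<lambda>t. k (Complex \<sigma> t))"
  by (rule continuous_on_compose2[OF assms(1)]) (use assms(2) in \<open>auto intro!: continuous_intros\<close>)

lemma open_half_plane: "open (half_plane \<theta>)" and convex_half_plane: "convex (half_plane \<theta>)"
  using open_halfspace_Re_gt convex_halfspace_Re_gt by auto

lemma tendsto_const_over_at_top: "((\<lambda>T. C / T) \<longlongrightarrow> 0) at_top" for C :: real
  by real_asymp

text \<open>The mean over a vertical line does not depend on the line when \<open>k\<close> is bounded in the strip between:
with a primitive \<open>K\<close> of \<open>k\<close>, the two integrals over \<open>[0, T]\<close> differ by increments of \<open>K\<close> along two
horizontal segments of fixed length, which stay bounded while one divides by \<open>T\<close>.\<close>

lemma has_mean_shift_line:
  assumes hol: "k holomorphic_on half_plane 0" and \<sigma>: "0 < \<sigma>" "\<sigma> \<le> \<sigma>'"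
    and bd: "\<And>s. \<sigma> \<le> Re s \<Longrightarrow> Re s \<le> \<sigma>' \<Longrightarrow> norm (k s) \<le> M"
    and mean: "has_mean (\<lambda>t. k (Complex \<sigma>' t)) L"
  shows "has_mean (\<lambda>t. k (Complex \<sigma> t)) L"
proof -
  obtain K where K0: "\<And>s. s \<in> half_plane 0 \<Longrightarrow> (K has_field_derivative k s) (at s within half_plane 0)"
    using holomorphic_convex_primitive'[OF convex_half_plane open_half_plane hol] by blast
  then have K: "(K has_field_derivative k s) (at s)" if "s \<in> half_plane 0" for s
    using K0[OF that] at_within_open[OF that open_half_plane] by simp
  have int: "integral {0..T} (\<lambda>t. k (Complex s t)) = (K (Complex s T) - K (Complex s 0)) / \<i>"
    if "s > 0" "T > 0" for s T
    using that by (intro integral_unique has_integral_vertical[where S = "half_plane 0"] K) auto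
  have K_diff: "norm (K (Complex \<sigma> T) - K (Complex \<sigma>' T)) \<le> M * (\<sigma>' - \<sigma>)" for T
  proof -
    have "convex ({s. Re s \<ge> \<sigma>} \<inter> {s. Re s \<le> \<sigma>'})"
      by (intro convex_Int convex_halfspace_Re_ge convex_halfspace_Re_le)
    then have "norm (K (Complex \<sigma> T) - K (Complex \<sigma>' T)) \<le> M * norm (Complex \<sigma> T - Complex \<sigma>' T)"
    proof (rule field_differentiable_bound)
      fix z assume "z \<in> {s. Re s \<ge> \<sigma>} \<inter> {s. Re s \<le> \<sigma>'}"
      then show "(K has_field_derivative k z) (at z within {s. Re s \<ge> \<sigma>} \<inter> {s. Re s \<le> \<sigma>'})"
        "norm (k z) \<le> M"
        using \<sigma> by (auto intro!: has_field_derivative_at_within K bd)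
    qed (use \<sigma> in auto)
    also have "norm (Complex \<sigma> T - Complex \<sigma>' T) = \<sigma>' - \<sigma>"
      using \<sigma> by (simp add: cmod_def)
    finally show ?thesis .
  qed
  have diff: "norm (integral {0..T} (\<lambda>t. k (Complex \<sigma> t)) / of_real T
      - integral {0..T} (\<lambda>t. k (Complex \<sigma>' t)) / of_real T) \<le> (2 * M * (\<sigma>' - \<sigma>)) / T" if "T > 0" for T
  proof -
    have "integral {0..T} (\<lambda>t. k (Complex \<sigma> t)) - integral {0..T} (\<lambda>t. k (Complex \<sigma>' t))
       = ((K (Complex \<sigma> T) - K (Complex \<sigma>' T)) - (K (Complex \<sigma> 0) - K (Complex \<sigma>' 0))) / \<i>"
      using that \<sigma> by (simp add: int algebra_simps)
    also have "norm \<dots> \<le> norm (K (Complex \<sigma> T) - K (Complex \<sigma>' T)) + norm (K (Complex \<sigma> 0) - K (Complex \<sigma>' 0))"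
      unfolding norm_divide by (simp add: norm_triangle_ineq4)
    also have "\<dots> \<le> 2 * M * (\<sigma>' - \<sigma>)" using K_diff[of T] K_diff[of 0] by linarith
    finally show ?thesis using that
      by (simp add: norm_divide divide_right_mono flip: diff_divide_distrib)
  qed
  have "((\<lambda>T. integral {0..T} (\<lambda>t. k (Complex \<sigma> t)) / of_real T
      - integral {0..T} (\<lambda>t. k (Complex \<sigma>' t)) / of_real T) \<longlongrightarrow> 0) at_top"
    by (rule Lim_null_comparison[OF _ tendsto_const_over_at_top[of "2 * M * (\<sigma>' - \<sigma>)"]])
       (rule eventually_mono[OF eventually_gt_at_top[of 0]], rule diff)
  from tendsto_add[OF this mean[unfolded has_mean_def, THEN conjunct2]]
  show ?thesis unfolding has_mean_def
    using continuous_on_vertical[OF holomorphic_on_imp_continuous_on[OF hol] \<sigma>(1)] by simp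
qed

text \<open>The orthogonality relation behind all coefficient formulas: \<open>m\<^sup>-\<^sup>s n\<^sup>s\<close> is such an exponential with
frequency \<open>l = ln n - ln m\<close>.\<close>

lemma has_mean_exp:
  "has_mean (\<lambda>t. exp (Complex \<sigma> t * of_real l)) (if l = 0 then 1 else 0)"
proof (cases "l = 0")
  case True
  have "((\<lambda>T. of_real T / of_real T :: complex) \<longlongrightarrow> 1) at_top"
    by (rule tendsto_eventually) (rule eventually_mono[OF eventually_gt_at_top[of 0]], simp)
  moreover have "\<forall>\<^sub>F T in at_top. of_real T / of_real T = integral {0..T} (\<lambda>t. 1 :: complex) / of_real T"
    using eventually_gt_at_top[of 0] by (rule eventually_mono) (auto simp: scaleR_conv_of_real)
  ultimately show ?thesis using True unfolding has_mean_def
    by (auto intro: Lim_transform_eventually)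
next
  case False
  define B where "B = 2 * exp (\<sigma> * l) / \<bar>l\<bar>"
  have "norm (integral {0..T} (\<lambda>t. exp (Complex \<sigma> t * of_real l)) / of_real T) \<le> B / T" if "T > 0" for T
  proof -
    have "((\<lambda>t. exp (Complex \<sigma> t * of_real l)) has_integral
       (exp (Complex \<sigma> T * of_real l) / of_real l - exp (Complex \<sigma> 0 * of_real l) / of_real l) / \<i>) {0..T}"
      using that False
      by (intro has_integral_vertical[where S = UNIV]) (auto intro!: derivative_eq_intros)
    then have "integral {0..T} (\<lambda>t. exp (Complex \<sigma> t * of_real l)) =
       (exp (Complex \<sigma> T * of_real l) / of_real l - exp (Complex \<sigma> 0 * of_real l) / of_real l) / \<i>"
      by (rule integral_unique)
    also have "norm \<dots> \<le> norm (exp (Complex \<sigma> T * of_real l) / of_real l) + norm (exp (Complex \<sigma> 0 * of_real l) / of_real l)"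
      unfolding norm_divide[of _ \<i>] by (simp add: norm_triangle_ineq4)
    also have "\<dots> = B" unfolding B_def by (simp add: norm_divide)
    finally show ?thesis using that by (simp add: norm_divide divide_right_mono)
  qed
  note bound = this
  have "((\<lambda>T. integral {0..T} (\<lambda>t. exp (Complex \<sigma> t * of_real l)) / of_real T) \<longlongrightarrow> 0) at_top"
    by (rule Lim_null_comparison[OF _ tendsto_const_over_at_top[of B]])
       (rule eventually_mono[OF eventually_gt_at_top[of 0]], rule bound)
  then show ?thesis using False unfolding has_mean_def
    by (auto intro!: continuous_intros)
qed

section \<open>Coefficients of Dirichlet series as means\<close>

lemma norm_nat_powr: "norm (of_nat n powr s :: complex) = real n powr Re s"
  by (simp add: norm_powr_real_powr)

lemma nat_powr_mult: "(of_nat (m * n) powr s :: complex) = of_nat m powr s * of_nat n powr s"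
  by (simp add: powr_times_real)

lemma nat_powr_exp: "n \<ge> 1 \<Longrightarrow> (of_nat n powr s :: complex) = exp (s * of_real (ln (real n)))"
  by (simp add: powr_def Ln_of_nat)

lemma nat_powr_antimono: "\<sigma> \<le> \<sigma>' \<Longrightarrow> real n powr - \<sigma>' \<le> real n powr - \<sigma>"
  by (cases "n = 0") (auto intro: powr_mono)

text \<open>Absolute convergence at \<open>\<sigma>\<close>, hence on the closed half-plane to its right. Nothing is said about \<open>h\<close>
further left, so \<open>h\<close> may be holomorphic far beyond the half-plane of convergence.\<close>

definition abs_dirichlet :: "real \<Rightarrow> (nat \<Rightarrow> complex) \<Rightarrow> (complex \<Rightarrow> complex) \<Rightarrow> bool" where
  "abs_dirichlet \<sigma> b h \<longleftrightarrow> b 0 = 0 \<and> (\<lambda>n. norm (b n) * real n powr - \<sigma>) summable_on UNIV \<and>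
     (\<forall>s. \<sigma> \<le> Re s \<longrightarrow> ((\<lambda>n. b n * of_nat n powr - s) has_sum h s) UNIV)"

definition dirichlet_norm :: "real \<Rightarrow> (nat \<Rightarrow> complex) \<Rightarrow> real" where
  "dirichlet_norm \<sigma> b = (\<Sum>\<^sub>\<infinity>n. norm (b n) * real n powr - \<sigma>)"

lemma dirichlet_norm_nonneg: "0 \<le> dirichlet_norm \<sigma> b"
  unfolding dirichlet_norm_def by (rule infsum_nonneg) simp

lemma abs_dirichlet_mono:
  assumes "abs_dirichlet \<sigma> b h" "\<sigma> \<le> \<sigma>'"
  shows "abs_dirichlet \<sigma>' b h"
  using assms unfolding abs_dirichlet_def
  by (auto intro!: summable_on_comparison_test[where f = "\<lambda>n. norm (b n) * real n powr - \<sigma>"]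
      mult_left_mono nat_powr_antimono)

lemma abs_dirichlet_norm_bound:
  assumes "abs_dirichlet \<sigma> b h" "\<sigma> \<le> Re s"
  shows "norm (h s) \<le> dirichlet_norm \<sigma> b"
proof (rule norm_infsum_le)
  show "((\<lambda>n. b n * of_nat n powr - s) has_sum h s) UNIV"
    using assms unfolding abs_dirichlet_def by blast
  show "((\<lambda>n. norm (b n) * real n powr - \<sigma>) has_sum dirichlet_norm \<sigma> b) UNIV"
    using assms unfolding abs_dirichlet_def dirichlet_norm_def by (simp add: has_sum_infsum)
  show "norm (b n * of_nat n powr - s) \<le> norm (b n) * real n powr - \<sigma>" for n
    using assms(2) by (simp add: norm_mult norm_nat_powr mult_left_mono nat_powr_antimono)
qed

lemma abs_dirichlet_sums:
  assumes "abs_dirichlet \<sigma> b h" "\<sigma> \<le> Re s"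
  shows "(\<lambda>n. b n * of_nat n powr - s) sums h s"
  using assms unfolding abs_dirichlet_def by (blast intro: has_sum_imp_sums)

lemma abs_dirichlet_summable:
  "abs_dirichlet \<sigma> b h \<Longrightarrow> summable (\<lambda>n. norm (b n) * real n powr - \<sigma>)"
  unfolding abs_dirichlet_def by (blast intro: summable_on_imp_summable)

lemma abs_dirichletI:
  assumes "b 0 = 0" "summable (\<lambda>n. norm (b n) * real n powr - \<sigma>)"
    and "\<And>s. \<sigma> \<le> Re s \<Longrightarrow> (\<lambda>n. b n * of_nat n powr - s) sums h s"
  shows "abs_dirichlet \<sigma> b h"
  unfolding abs_dirichlet_def
proof (intro conjI allI impI)
  show "b 0 = 0" by fact
  show "(\<lambda>n. norm (b n) * real n powr - \<sigma>) summable_on UNIV"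
    using assms(2) by (intro norm_summable_imp_summable_on) simp
  fix s :: complex assume s: "\<sigma> \<le> Re s"
  show "((\<lambda>n. b n * of_nat n powr - s) has_sum h s) UNIV"
  proof (rule norm_summable_imp_has_sum[OF _ assms(3)[OF s]])
    show "summable (\<lambda>n. norm (b n * of_nat n powr - s))"
      by (rule summable_comparison_test'[OF assms(2)])
        (use s in \<open>simp add: norm_mult norm_nat_powr mult_left_mono nat_powr_antimono\<close>)
  qed
qed

lemma abs_dirichlet_tail_bound:
  assumes b: "abs_dirichlet \<sigma> b h" and s: "\<sigma> \<le> Re s"
  shows "norm (h s - (\<Sum>n<N. b n * of_nat n powr - s))
     \<le> (\<Sum>n. norm (b n) * real n powr - \<sigma>) - (\<Sum>n<N. norm (b n) * real n powr - \<sigma>)"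
proof -
  let ?f = "\<lambda>n. b n * of_nat n powr - s" and ?g = "\<lambda>n. norm (b n) * real n powr - \<sigma>"
  have le: "norm (?f n) \<le> ?g n" for n
    using s by (simp add: norm_mult norm_nat_powr mult_left_mono nat_powr_antimono)
  have g: "summable ?g" by (rule abs_dirichlet_summable[OF b])
  have f: "?f sums h s" by (rule abs_dirichlet_sums[OF b s])
  have "h s - (\<Sum>n<N. ?f n) = (\<Sum>n. ?f (n + N))"
    using suminf_minus_initial_segment[OF sums_summable[OF f], of N] sums_unique[OF f] by simp
  also have "norm \<dots> \<le> (\<Sum>n. ?g (n + N))"
    by (intro norm_suminf_le le summable_ignore_initial_segment g)
  also have "\<dots> = suminf ?g - (\<Sum>n<N. ?g n)"
    by (rule suminf_minus_initial_segment[OF g])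
  finally show ?thesis .
qed

lemma has_mean_nat_powr:
  assumes "m \<ge> 1" "n \<ge> 1"
  shows "has_mean (\<lambda>t. of_nat m powr - Complex \<sigma> t * of_nat n powr Complex \<sigma> t) (if m = n then 1 else 0)"
proof -
  have "of_nat m powr - s * of_nat n powr s = exp (s * of_real (ln (real n) - ln (real m)))" for s :: complex
    using assms by (simp add: nat_powr_exp algebra_simps flip: exp_add)
  moreover have "ln (real n) - ln (real m) = 0 \<longleftrightarrow> m = n"
    using assms by (auto simp: ln_inj_iff)
  ultimately show ?thesis using has_mean_exp[of \<sigma> "ln (real n) - ln (real m)"] by simp
qed

text \<open>On the line \<open>Re s = \<sigma>\<close> of absolute convergence the partial sums converge uniformly, so the mean can be
taken term by term.\<close>

lemma mean_of_coefficient_far: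
  assumes b: "abs_dirichlet \<sigma> b h" and n: "n \<ge> 1"
  shows "has_mean (\<lambda>t. h (Complex \<sigma> t) * of_nat n powr Complex \<sigma> t) (b n)"
proof (rule has_mean_uniform_limit)
  let ?F = "\<lambda>N t. \<Sum>m<N. b m * of_nat m powr - Complex \<sigma> t"
  let ?g = "\<lambda>n. norm (b n) * real n powr - \<sigma>"
  show "has_mean (\<lambda>t. ?F N t * of_nat n powr Complex \<sigma> t) (\<Sum>m<N. b m * (if m = n then 1 else 0))" for N
    unfolding sum_distrib_right mult.assoc
  proof (intro has_mean_sum)
    fix m show "has_mean (\<lambda>t. b m * (of_nat m powr - Complex \<sigma> t * of_nat n powr Complex \<sigma> t))
        (b m * (if m = n then 1 else 0))"
      using b has_mean_nat_powr[of m n \<sigma>, THEN has_mean_cmult, of "b m"] n has_mean_zero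
      unfolding abs_dirichlet_def by (cases "m = 0") auto
  qed simp
  show "(\<lambda>N. \<Sum>m<N. b m * (if m = n then 1 else 0)) \<longlonglongrightarrow> b n"
    by (rule tendsto_eventually, rule eventually_mono[OF eventually_gt_at_top[of n]])
      (simp add: if_distrib sum.delta cong: if_cong)
  show "norm (h (Complex \<sigma> t) * of_nat n powr Complex \<sigma> t - ?F N t * of_nat n powr Complex \<sigma> t)
      \<le> (suminf ?g - sum ?g {..<N}) * real n powr \<sigma>" for N t
    using abs_dirichlet_tail_bound[OF b, of "Complex \<sigma> t" N]
    by (simp add: norm_mult norm_nat_powr mult_right_mono flip: left_diff_distrib)
  have "(\<lambda>N. (suminf ?g - sum ?g {..<N}) * real n powr \<sigma>) \<longlonglongrightarrow> (suminf ?g - suminf ?g) * real n powr \<sigma>"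
    by (intro tendsto_intros summable_LIMSEQ abs_dirichlet_summable[OF b])
  then show "(\<lambda>N. (suminf ?g - sum ?g {..<N}) * real n powr \<sigma>) \<longlonglongrightarrow> 0" by simp
qed

text \<open>Coefficients are means, and means are unique.\<close>

lemma abs_dirichlet_unique:
  assumes "abs_dirichlet \<sigma> b h" "abs_dirichlet \<sigma> c h"
  shows "b = c"
proof
  fix n show "b n = c n"
    using mean_of_coefficient_far[OF assms(1), of n] mean_of_coefficient_far[OF assms(2), of n]
      has_mean_unique assms by (cases "n = 0") (auto simp: abs_dirichlet_def)
qed

text \<open>For a bounded holomorphic \<open>h\<close> the coefficient formula persists on every line to the right of the
imaginary axis, whether or not the series converges there.\<close>

lemma mean_of_coefficient:
  assumes b: "abs_dirichlet \<sigma>' b h" and \<sigma>: "0 < \<sigma>" "\<sigma> \<le> \<sigma>'" and n: "n \<ge> 1"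
    and hol: "h holomorphic_on half_plane 0" and bd: "\<And>s. Re s > 0 \<Longrightarrow> norm (h s) \<le> M"
  shows "has_mean (\<lambda>t. h (Complex \<sigma> t) * of_nat n powr Complex \<sigma> t) (b n)"
proof (rule has_mean_shift_line[where k = "\<lambda>s. h s * of_nat n powr s"])
  show "(\<lambda>s. h s * of_nat n powr s) holomorphic_on half_plane 0"
    using n by (intro holomorphic_intros hol) auto
  show "norm (h s * of_nat n powr s) \<le> M * real n powr \<sigma>'" if "\<sigma> \<le> Re s" "Re s \<le> \<sigma>'" for s
  proof -
    have "norm (h s) \<le> M" using that \<sigma> by (intro bd) simp
    moreover have "real n powr Re s \<le> real n powr \<sigma>'" using that n by (intro powr_mono) auto
    ultimately show ?thesis
      unfolding norm_mult norm_nat_powr by (intro mult_mono) (auto intro: order.trans[OF norm_ge_zero])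
  qed
  show "has_mean (\<lambda>t. h (Complex \<sigma>' t) * of_nat n powr Complex \<sigma>' t) (b n)"
    by (rule mean_of_coefficient_far[OF b n])
qed (use \<sigma> in auto)

lemma cnj_nat_powr:
  assumes "n \<ge> 1"
  shows "cnj (of_nat n powr - Complex \<sigma> t) = of_real (real n powr (- 2 * \<sigma>)) * of_nat n powr Complex \<sigma> t"
proof -
  have "cnj (of_nat n powr - Complex \<sigma> t) = exp (cnj (- Complex \<sigma> t * of_real (ln (real n))))"
    using assms by (simp add: nat_powr_exp exp_cnj)
  also have "cnj (- Complex \<sigma> t * of_real (ln (real n)))
      = of_real (- 2 * \<sigma> * ln (real n)) + Complex \<sigma> t * of_real (ln (real n))"
    by (simp add: complex_eq_iff)
  finally show ?thesis
    using assms by (simp only: exp_add exp_of_real nat_powr_exp) (simp add: powr_def)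
qed

lemma has_mean_times_cnj_polynomial:
  assumes "finite A" "\<And>n. n \<in> A \<Longrightarrow> n \<ge> 1"
    and "\<And>n. n \<in> A \<Longrightarrow> has_mean (\<lambda>t. f t * of_nat n powr Complex \<sigma> t) (b n)"
  shows "has_mean (\<lambda>t. f t * cnj (\<Sum>n\<in>A. g n * of_nat n powr - Complex \<sigma> t))
           (\<Sum>n\<in>A. cnj (g n) * of_real (real n powr (- 2 * \<sigma>)) * b n)"
proof -
  have "f t * cnj (\<Sum>n\<in>A. g n * of_nat n powr - Complex \<sigma> t) =
     (\<Sum>n\<in>A. (cnj (g n) * of_real (real n powr (- 2 * \<sigma>))) * (f t * of_nat n powr Complex \<sigma> t))" for t
    using assms(2) by (simp add: cnj_nat_powr sum_distrib_left algebra_simps)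
  then show ?thesis
    by (simp only:) (intro has_mean_sum has_mean_cmult assms)
qed

lemma has_mean_polynomial_coefficient:
  assumes "finite A" "\<And>n. n \<in> A \<Longrightarrow> n \<ge> 1" "k \<in> A"
  shows "has_mean (\<lambda>t. (\<Sum>n\<in>A. g n * of_nat n powr - Complex \<sigma> t) * of_nat k powr Complex \<sigma> t) (g k)"
proof -
  have "has_mean (\<lambda>t. \<Sum>n\<in>A. g n * (of_nat n powr - Complex \<sigma> t * of_nat k powr Complex \<sigma> t))
     (\<Sum>n\<in>A. g n * (if n = k then 1 else 0))"
    using assms by (intro has_mean_sum has_mean_cmult has_mean_nat_powr) auto
  then show ?thesis using assms
    by (simp add: sum_distrib_right mult.assoc if_distrib sum.delta cong: if_cong)
qed

text \<open>Bessel's inequality in the mean. Let \<open>P\<close> be a partial sum of the series of \<open>h\<close>. On a line \<open>Re s = \<sigma>\<close>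
the mean of \<open>2 h cnj P - P cnj P\<close> is \<open>\<Sum> \<bar>b\<^sub>n\<bar>\<^sup>2 n\<^sup>-\<^sup>2\<^sup>\<sigma>\<close>, while its real part is at most
\<open>\<bar>h\<bar>\<^sup>2 \<le> \<bar>G\<bar>\<^sup>2\<close> for the dominating polynomial \<open>G\<close>, whose mean square is explicit. The claim is the
limit \<open>\<sigma> \<rightarrow> 0\<close>.\<close>

lemma coefficients_le_of_dominated:
  assumes b: "abs_dirichlet \<sigma>\<^sub>0 b h" and \<sigma>0: "\<sigma>\<^sub>0 > 0"
    and hol: "h holomorphic_on half_plane 0"
    and A: "finite A" "\<And>n. n \<in> A \<Longrightarrow> n \<ge> 1"
    and dom: "\<And>s. Re s > 0 \<Longrightarrow> norm (h s) \<le> norm (\<Sum>n\<in>A. g n * of_nat n powr - s)"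
  shows "(\<Sum>n=1..N. (norm (b n))\<^sup>2) \<le> (\<Sum>n\<in>A. (norm (g n))\<^sup>2)"
proof -
  define S where "S \<sigma> = (\<Sum>n=1..N. (norm (b n))\<^sup>2 * real n powr (- 2 * \<sigma>))" for \<sigma>
  have bd: "norm (h s) \<le> (\<Sum>n\<in>A. norm (g n))" if s: "Re s > 0" for s
  proof -
    have "norm (\<Sum>n\<in>A. g n * of_nat n powr - s) \<le> (\<Sum>n\<in>A. norm (g n))"
    proof (rule sum_norm_le)
      fix n assume "n \<in> A"
      then have "real n powr - Re s \<le> real n powr 0" using A(2)[of n] s by (intro powr_mono) auto
      then show "norm (g n * of_nat n powr - s) \<le> norm (g n)"
        using A(2)[OF \<open>n \<in> A\<close>] by (simp add: norm_mult norm_nat_powr mult_left_le)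
    qed
    then show ?thesis using dom[OF s] by linarith
  qed
  have line: "S \<sigma> \<le> (\<Sum>n\<in>A. (norm (g n))\<^sup>2)" if \<sigma>: "0 < \<sigma>" "\<sigma> \<le> \<sigma>\<^sub>0" for \<sigma>
  proof -
    define P where "P t = (\<Sum>n=1..N. b n * of_nat n powr - Complex \<sigma> t)" for t
    define G where "G t = (\<Sum>n\<in>A. g n * of_nat n powr - Complex \<sigma> t)" for t
    define H where "H t = h (Complex \<sigma> t)" for t
    \<comment> \<open>the shape in which \<open>has_mean_times_cnj_polynomial\<close> delivers \<open>\<bar>z\<bar>\<^sup>2 r\<close>\<close>
    have sq: "cnj z * of_real r * z = of_real ((norm z)\<^sup>2 * r)" for z r
      using complex_norm_square[of z] by (simp add: mult_ac)
    have 1: "has_mean (\<lambda>t. H t * cnj (P t)) (of_real (S \<sigma>))"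
      unfolding H_def P_def S_def of_real_sum sq[symmetric]
      by (intro has_mean_times_cnj_polynomial mean_of_coefficient[OF b \<sigma> _ hol bd]) auto
    have 2: "has_mean (\<lambda>t. P t * cnj (P t)) (of_real (S \<sigma>))"
      unfolding P_def S_def of_real_sum sq[symmetric]
      by (intro has_mean_times_cnj_polynomial has_mean_polynomial_coefficient) auto
    have 3: "has_mean (\<lambda>t. G t * cnj (G t)) (of_real (\<Sum>n\<in>A. (norm (g n))\<^sup>2 * real n powr (- 2 * \<sigma>)))"
      unfolding G_def of_real_sum sq[symmetric]
      by (intro has_mean_times_cnj_polynomial has_mean_polynomial_coefficient A)
    have "Re (2 * of_real (S \<sigma>) - of_real (S \<sigma>)) \<le>
        Re (of_real (\<Sum>n\<in>A. (norm (g n))\<^sup>2 * real n powr (- 2 * \<sigma>)))"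
    proof (rule has_mean_Re_mono[OF has_mean_diff[OF has_mean_cmult[OF 1, of 2] 2] 3])
      fix t :: real
      have "norm (H t) \<le> norm (G t)" unfolding H_def G_def using \<sigma> by (intro dom) simp
      then have "(norm (H t))\<^sup>2 \<le> (norm (G t))\<^sup>2" by (rule power_mono) simp
      \<comment> \<open>expanding \<open>\<bar>H - P\<bar>\<^sup>2 \<ge> 0\<close> bounds the Bessel sum from above\<close>
      moreover have "0 \<le> (norm (H t - P t))\<^sup>2" by simp
      then have "2 * Re (H t * cnj (P t)) - (norm (P t))\<^sup>2 \<le> (norm (H t))\<^sup>2"
        unfolding cmod_power2 by (simp add: power2_eq_square algebra_simps)
      moreover have sq': "Re (z * cnj z) = (norm z)\<^sup>2" for z
        unfolding complex_norm_square[symmetric] by simp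
      moreover have "Re (2 * (H t * cnj (P t)) - P t * cnj (P t)) = 2 * Re (H t * cnj (P t)) - (norm (P t))\<^sup>2"
        unfolding minus_complex.sel sq' by simp
      ultimately show "Re (2 * (H t * cnj (P t)) - P t * cnj (P t)) \<le> Re (G t * cnj (G t))"
        by (metis order.trans)
    qed
    then have "S \<sigma> \<le> (\<Sum>n\<in>A. (norm (g n))\<^sup>2 * real n powr (- 2 * \<sigma>))" by simp
    also have "\<dots> \<le> (\<Sum>n\<in>A. (norm (g n))\<^sup>2)"
    proof (rule sum_mono)
      fix n assume "n \<in> A"
      then have "real n powr (- 2 * \<sigma>) \<le> real n powr 0" using A(2)[of n] \<sigma> by (intro powr_mono) auto
      then show "(norm (g n))\<^sup>2 * real n powr (- 2 * \<sigma>) \<le> (norm (g n))\<^sup>2"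
        using A(2)[OF \<open>n \<in> A\<close>] by (simp add: mult_left_le)
    qed
    finally show ?thesis .
  qed
  have "(S \<longlongrightarrow> (\<Sum>n=1..N. (norm (b n))\<^sup>2 * real n powr (- 2 * 0))) (at_right 0)"
    unfolding S_def by (intro tendsto_intros) auto
  moreover have "\<forall>\<^sub>F \<sigma> in at_right 0. S \<sigma> \<le> (\<Sum>n\<in>A. (norm (g n))\<^sup>2)"
    unfolding eventually_at_right_field using line \<sigma>0 by (intro exI[of _ "\<sigma>\<^sub>0"]) auto
  ultimately have "(\<Sum>n=1..N. (norm (b n))\<^sup>2 * real n powr (- 2 * 0)) \<le> (\<Sum>n\<in>A. (norm (g n))\<^sup>2)"
    by (intro tendsto_upperbound[where F = "at_right (0 :: real)"]) auto
  then show ?thesis by simp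
qed

section \<open>Dirichlet convolution and composition with power series\<close>

text \<open>For \<open>n = 0\<close> the index set is infinite, so the value is \<open>0\<close>, in line with the normalization of
coefficient sequences at index \<open>0\<close>.\<close>

definition dconv :: "(nat \<Rightarrow> 'a) \<Rightarrow> (nat \<Rightarrow> 'a) \<Rightarrow> nat \<Rightarrow> 'a::comm_semiring_1" where
  "dconv u v n = (\<Sum>d | d dvd n. u d * v (n div d))"

lemma dconv_0 [simp]: "dconv u v 0 = 0"
  unfolding dconv_def by simp

text \<open>A completely multiplicative weight such as \<open>n\<^sup>-\<^sup>s\<close> factors out of a Dirichlet convolution; this reduces
products of Dirichlet series to products of numerical series.\<close>

lemma dconv_weight:
  fixes w :: "nat \<Rightarrow> 'a :: comm_semiring_1"
  assumes "\<And>m n. w (m * n) = w m * w n"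
  shows "dconv (\<lambda>n. u n * w n) (\<lambda>n. v n * w n) = (\<lambda>n. dconv u v n * w n)"
  unfolding dconv_def sum_distrib_right
proof (intro ext sum.cong refl)
  fix n d :: nat assume "d \<in> {d. d dvd n}"
  then have "w n = w d * w (n div d)" by (simp flip: assms)
  then show "u d * w d * (v (n div d) * w (n div d)) = u d * v (n div d) * w n" by (simp add: mult_ac)
qed

text \<open>The double series over pairs \<open>(d, e)\<close> converges absolutely; regrouping it by the product \<open>n = d e\<close>
turns it into the convolution.\<close>

lemma dconv_has_sum:
  fixes u v :: "nat \<Rightarrow> 'a :: {real_normed_field, banach}"
  assumes u: "(u has_sum U) UNIV" "(\<lambda>n. norm (u n)) summable_on UNIV" "u 0 = 0"
    and v: "(v has_sum V) UNIV" "(\<lambda>n. norm (v n)) summable_on UNIV" "v 0 = 0"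
  shows "(dconv u v has_sum U * V) UNIV"
proof -
  let ?f = "\<lambda>(d, e). u d * v e"
  have "(\<lambda>(d, e). norm (u d) * norm (v e)) summable_on UNIV \<times> UNIV"
    by (rule summable_on_SigmaI[where g = "\<lambda>d. norm (u d) * infsum (\<lambda>e. norm (v e)) UNIV"])
      (auto intro!: has_sum_cmult_right summable_on_cmult_left u(2) v(2) has_sum_infsum)
  then have "(\<lambda>x. norm (?f x)) summable_on UNIV \<times> UNIV"
    by (simp add: case_prod_unfold norm_mult)
  then have "?f summable_on UNIV \<times> UNIV" by (rule abs_summable_summable)
  moreover have "((\<lambda>e. u d * v e) has_sum u d * V) UNIV" for d
    by (intro has_sum_cmult_right v)
  ultimately have "(?f has_sum U * V) (UNIV \<times> UNIV)"
    using has_sum_cmult_left[OF u(1), of V]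
    by (intro has_sum_SigmaI[where g = "\<lambda>d. u d * V"]) auto
  also have "?this \<longleftrightarrow> (?f has_sum U * V) ({1..} \<times> {1..})"
    using u(3) v(3) by (intro has_sum_cong_neutral) (auto simp: Suc_le_eq intro: Nat.gr0I)
  also have "\<dots> \<longleftrightarrow> ((\<lambda>(n, d). u d * v (n div d)) has_sum U * V) (Sigma {1..} (\<lambda>n. {d. d dvd n}))"
    by (rule has_sum_reindex_bij_witness[where j = "\<lambda>(d, e). (d * e, d)" and i = "\<lambda>(n, d). (d, n div d)"])
      (auto simp: Suc_le_eq dvd_def intro: Nat.gr0I)
  finally have "(dconv u v has_sum U * V) {1..}"
    by (rule has_sum_SigmaD) (auto simp: dconv_def intro!: has_sum_finiteI)
  also have "?this \<longleftrightarrow> ?thesis"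
    by (intro has_sum_cong_neutral) (auto simp: not_le)
  finally show ?thesis .
qed

lemma norm_dconv_le:
  fixes u v :: "nat \<Rightarrow> complex"
  shows "norm (dconv u v n) \<le> dconv (\<lambda>n. norm (u n)) (\<lambda>n. norm (v n)) n"
  unfolding dconv_def by (rule sum_norm_le) (simp add: norm_mult)

lemma abs_dirichlet_dconv:
  assumes b: "abs_dirichlet \<sigma> b h" and c: "abs_dirichlet \<sigma> c k"
  shows "abs_dirichlet \<sigma> (dconv b c) (\<lambda>s. h s * k s)"
    and "dirichlet_norm \<sigma> (dconv b c) \<le> dirichlet_norm \<sigma> b * dirichlet_norm \<sigma> c"
proof -
  let ?w = "\<lambda>n. real n powr - \<sigma>"
  have w: "?w (m * n) = ?w m * ?w n" for m n by (simp add: powr_mult)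
  have "(dconv (\<lambda>n. norm (b n) * ?w n) (\<lambda>n. norm (c n) * ?w n) has_sum
      dirichlet_norm \<sigma> b * dirichlet_norm \<sigma> c) UNIV"
    using b c unfolding abs_dirichlet_def dirichlet_norm_def by (intro dconv_has_sum) auto
  then have N: "((\<lambda>n. dconv (\<lambda>n. norm (b n)) (\<lambda>n. norm (c n)) n * ?w n) has_sum
      dirichlet_norm \<sigma> b * dirichlet_norm \<sigma> c) UNIV"
    by (simp add: dconv_weight[where w = ?w, OF w])
  have le: "norm (dconv b c n) * ?w n \<le> dconv (\<lambda>n. norm (b n)) (\<lambda>n. norm (c n)) n * ?w n" for n
    by (intro mult_right_mono norm_dconv_le) simp
  have summ: "(\<lambda>n. norm (dconv b c n) * ?w n) summable_on UNIV"
    by (rule summable_on_comparison_test[OF has_sum_imp_summable[OF N]]) (use le in auto)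
  then show "dirichlet_norm \<sigma> (dconv b c) \<le> dirichlet_norm \<sigma> b * dirichlet_norm \<sigma> c"
    unfolding dirichlet_norm_def[of \<sigma> "dconv b c"]
    by (intro has_sum_mono[OF has_sum_infsum N] le)
  have "((\<lambda>n. dconv b c n * of_nat n powr - s) has_sum h s * k s) UNIV" if s: "\<sigma> \<le> Re s" for s
  proof -
    let ?z = "\<lambda>n. of_nat n powr - s :: complex"
    have "(\<lambda>n. norm (a n * ?z n)) summable_on UNIV" if "abs_dirichlet \<sigma> a l" for a l
      using abs_dirichlet_mono[OF that s] unfolding abs_dirichlet_def
      by (simp add: norm_mult norm_nat_powr)
    then have "(dconv (\<lambda>n. b n * ?z n) (\<lambda>n. c n * ?z n) has_sum h s * k s) UNIV"
      using b c s unfolding abs_dirichlet_def by (intro dconv_has_sum) (use b c in auto)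
    then show ?thesis
      by (simp add: dconv_weight[where w = ?z, OF nat_powr_mult])
  qed
  then show "abs_dirichlet \<sigma> (dconv b c) (\<lambda>s. h s * k s)"
    unfolding abs_dirichlet_def using summ by simp
qed

primrec dconv_pow :: "(nat \<Rightarrow> complex) \<Rightarrow> nat \<Rightarrow> nat \<Rightarrow> complex" where
  "dconv_pow b 0 = (\<lambda>n. if n = 1 then 1 else 0)"
| "dconv_pow b (Suc k) = dconv b (dconv_pow b k)"

lemma abs_dirichlet_dconv_pow:
  assumes "abs_dirichlet \<sigma> b h"
  shows "abs_dirichlet \<sigma> (dconv_pow b k) (\<lambda>s. h s ^ k) \<and>
    dirichlet_norm \<sigma> (dconv_pow b k) \<le> dirichlet_norm \<sigma> b ^ k"
proof (induction k)
  case 0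
  have 1: "((\<lambda>n. (if n = 1 then 1 else 0) * of_nat n powr - s) has_sum 1) UNIV" for s :: complex
    by (rule has_sum_finite_neutralI[of "{1}"]) auto
  have 2: "((\<lambda>n. norm (if n = 1 then 1 else 0 :: complex) * real n powr - \<sigma>) has_sum 1) UNIV"
    by (rule has_sum_finite_neutralI[of "{1}"]) auto
  show ?case
    unfolding abs_dirichlet_def dirichlet_norm_def
    using 1 has_sum_imp_summable[OF 2] infsumI[OF 2] by simp
next
  case (Suc k)
  have "dirichlet_norm \<sigma> b * dirichlet_norm \<sigma> (dconv_pow b k) \<le> dirichlet_norm \<sigma> b * dirichlet_norm \<sigma> b ^ k"
    using Suc by (intro mult_left_mono dirichlet_norm_nonneg) auto
  then show ?case
    using abs_dirichlet_dconv[OF assms, of "dconv_pow b k"] Suc by fastforce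
qed

text \<open>If the series starts at \<open>n = 2\<close>, its \<open>k\<close>-th power starts at \<open>n = 2\<^sup>k\<close>. Hence each coefficient of a
composition with a power series is a finite sum.\<close>

lemma dconv_pow_eq_0:
  assumes "b 0 = 0" "b 1 = 0" "n < 2 ^ k"
  shows "dconv_pow b k n = 0"
  using assms(3)
proof (induction k arbitrary: n)
  case (Suc k)
  show ?case
    unfolding dconv_pow.simps dconv_def
  proof (rule sum.neutral, safe)
    fix d assume d: "d dvd n"
    show "b d * dconv_pow b k (n div d) = 0"
    proof (cases "d \<le> 1")
      case True
      then have "d = 0 \<or> d = 1" by auto
      then show ?thesis using assms by auto
    next
      case False
      then have "n div d \<le> n div 2" by (intro div_le_mono2) auto
      also have "n div 2 < 2 ^ k" using Suc.prems by auto
      finally show ?thesis using Suc.IH by simp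
    qed
  qed
qed simp

lemma dconv_pow_eq_0': "b 0 = 0 \<Longrightarrow> b 1 = 0 \<Longrightarrow> n < k \<Longrightarrow> dconv_pow b k n = 0"
  by (rule dconv_pow_eq_0) (auto intro: less_trans[OF _ less_exp])

text \<open>Formal composition of the power series with coefficients \<open>a\<close> and a Dirichlet series whose coefficients
\<open>b\<close> vanish at \<open>0\<close> and \<open>1\<close>: all terms with \<open>k > n\<close> vanish.\<close>

definition dirichlet_compose :: "(nat \<Rightarrow> complex) \<Rightarrow> (nat \<Rightarrow> complex) \<Rightarrow> nat \<Rightarrow> complex" where
  "dirichlet_compose a b n = (\<Sum>k\<le>n. a k * dconv_pow b k n)"

lemma dirichlet_compose_eq:
  assumes "b 0 = 0" "b 1 = 0" "n < K"
  shows "dirichlet_compose a b n = (\<Sum>k<K. a k * dconv_pow b k n)"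
  unfolding dirichlet_compose_def
  by (rule sum.mono_neutral_left) (use assms in \<open>auto simp: dconv_pow_eq_0'\<close>)

text \<open>The double series \<open>\<Sum>k n. a\<^sub>k (b\<^sup>*\<^sup>k)\<^sub>n n\<^sup>-\<^sup>s\<close> is dominated by \<open>\<Sum>k. \<bar>a\<^sub>k\<bar> (dirichlet_norm \<sigma> b)\<^sup>k\<close>, so
the two orders of summation agree.\<close>

lemma abs_dirichlet_compose:
  assumes b: "abs_dirichlet \<sigma> b h" and b1: "b 1 = 0"
    and a: "summable (\<lambda>k. norm (a k) * dirichlet_norm \<sigma> b ^ k)"
  shows "abs_dirichlet \<sigma> (dirichlet_compose a b) (\<lambda>s. \<Sum>k. a k * h s ^ k)"
proof -
  have b0: "b 0 = 0" using b unfolding abs_dirichlet_def by simp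
  have p: "abs_dirichlet \<sigma> (dconv_pow b k) (\<lambda>s. h s ^ k)"
    "dirichlet_norm \<sigma> (dconv_pow b k) \<le> dirichlet_norm \<sigma> b ^ k" for k
    using abs_dirichlet_dconv_pow[OF b] by auto
  let ?f = "\<lambda>(k, n). norm (a k * dconv_pow b k n) * real n powr - \<sigma>"
  have "(\<lambda>k. norm (a k) * dirichlet_norm \<sigma> b ^ k) summable_on UNIV"
    using a by (intro norm_summable_imp_summable_on) (simp add: dirichlet_norm_nonneg)
  then have "(\<lambda>k. norm (a k) * dirichlet_norm \<sigma> (dconv_pow b k)) summable_on UNIV"
    by (rule summable_on_comparison_test) (auto intro!: mult_left_mono mult_nonneg_nonneg p dirichlet_norm_nonneg)
  moreover have "((\<lambda>n. ?f (k, n)) has_sum norm (a k) * dirichlet_norm \<sigma> (dconv_pow b k)) UNIV" for k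
    using has_sum_cmult_right[OF has_sum_infsum, of "\<lambda>n. norm (dconv_pow b k n) * real n powr - \<sigma>" UNIV "norm (a k)"]
      p(1)[of k]
    unfolding abs_dirichlet_def dirichlet_norm_def by (simp add: norm_mult mult_ac)
  ultimately have f: "?f summable_on UNIV \<times> UNIV"
    by (intro summable_on_SigmaI[where g = "\<lambda>k. norm (a k) * dirichlet_norm \<sigma> (dconv_pow b k)"]) auto
  have fin: "((\<lambda>k. norm (a k * dconv_pow b k n) * w) has_sum (\<Sum>k\<le>n. norm (a k * dconv_pow b k n) * w)) UNIV"
    "((\<lambda>k. a k * dconv_pow b k n * z) has_sum (\<Sum>k\<le>n. a k * dconv_pow b k n * z)) UNIV" for n w z
    by (rule has_sum_finite_neutralI[of "{..n}"]; use dconv_pow_eq_0'[OF b0 b1] in auto)+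
  show ?thesis
    unfolding abs_dirichlet_def
  proof (intro conjI allI impI)
    show "dirichlet_compose a b 0 = 0" unfolding dirichlet_compose_def by simp
    have "(\<lambda>(n, k). ?f (k, n)) summable_on UNIV \<times> UNIV"
      using f by (subst summable_on_swap) (simp add: case_prod_unfold)
    then have "(\<lambda>n. infsum (\<lambda>k. ?f (k, n)) UNIV) summable_on UNIV"
      by (rule summable_on_Sigma_banach)
    moreover have "infsum (\<lambda>k. ?f (k, n)) UNIV = (\<Sum>k\<le>n. norm (a k * dconv_pow b k n) * real n powr - \<sigma>)" for n
      using infsumI[OF fin(1)[of n "real n powr - \<sigma>"]] by simp
    ultimately have "(\<lambda>n. \<Sum>k\<le>n. norm (a k * dconv_pow b k n) * real n powr - \<sigma>) summable_on UNIV"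
      by simp
    then show "(\<lambda>n. norm (dirichlet_compose a b n) * real n powr - \<sigma>) summable_on UNIV"
      by (rule summable_on_comparison_test)
        (auto simp: dirichlet_compose_def simp flip: sum_distrib_right intro!: mult_right_mono norm_sum)
  next
    fix s :: complex assume s: "\<sigma> \<le> Re s"
    let ?g = "\<lambda>(k, n). a k * dconv_pow b k n * of_nat n powr - s"
    have "(\<lambda>x. norm (?g x)) summable_on UNIV \<times> UNIV"
      by (rule summable_on_comparison_test[OF f])
        (use s in \<open>auto simp: norm_mult norm_nat_powr intro!: mult_left_mono nat_powr_antimono\<close>)
    then have "?g summable_on UNIV \<times> UNIV" by (rule abs_summable_summable)
    then obtain S where S: "(?g has_sum S) (UNIV \<times> UNIV)" by (auto simp: summable_on_def)
    have "((\<lambda>n. a k * (dconv_pow b k n * of_nat n powr - s)) has_sum a k * h s ^ k) UNIV" for k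
      using p(1)[of k] s unfolding abs_dirichlet_def by (intro has_sum_cmult_right) auto
    then have "((\<lambda>k. a k * h s ^ k) has_sum S) UNIV"
      by (intro has_sum_SigmaD[OF S]) (simp add: mult.assoc)
    then have "S = (\<Sum>k. a k * h s ^ k)" by (intro sums_unique has_sum_imp_sums)
    moreover have "((\<lambda>(n, k). ?g (k, n)) has_sum S) (UNIV \<times> UNIV)"
      using S by (subst has_sum_swap) (simp add: case_prod_unfold)
    then have "((\<lambda>n. \<Sum>k\<le>n. a k * dconv_pow b k n * of_nat n powr - s) has_sum S) UNIV"
      by (rule has_sum_SigmaD) (use fin(2) in simp)
    ultimately show "((\<lambda>n. dirichlet_compose a b n * of_nat n powr - s) has_sum (\<Sum>k. a k * h s ^ k)) UNIV"
      unfolding dirichlet_compose_def by (simp add: sum_distrib_right)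
  qed
qed

text \<open>Without a constant term every term carries a factor \<open>n\<^sup>-\<^sup>x \<le> 2\<^sup>-\<^sup>x\<close> when one moves by \<open>x\<close> to the right.\<close>

lemma dirichlet_norm_small:
  assumes b: "abs_dirichlet \<sigma> b h" and b1: "b 1 = 0" and e: "e > 0"
  obtains \<sigma>' where "\<sigma> \<le> \<sigma>'" "dirichlet_norm \<sigma>' b < e"
proof -
  have *: "dirichlet_norm (\<sigma> + x) b \<le> 2 powr - x * dirichlet_norm \<sigma> b" if x: "x \<ge> 0" for x
  proof -
    have le: "norm (b n) * real n powr - (\<sigma> + x) \<le> 2 powr - x * (norm (b n) * real n powr - \<sigma>)" for n
    proof (cases "n \<le> 1")
      case True
      then have "n = 0 \<or> n = 1" by auto
      then show ?thesis using b b1 unfolding abs_dirichlet_def by auto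
    next
      case False
      then have "real n powr - x \<le> 2 powr - x" using x by (intro powr_mono2') auto
      then show ?thesis using False
        by (simp add: powr_add powr_diff powr_minus mult_left_mono mult_ac divide_simps)
    qed
    have b': "(\<lambda>n. norm (b n) * real n powr - \<sigma>) summable_on UNIV"
      using b unfolding abs_dirichlet_def by simp
    have "(\<lambda>n. norm (b n) * real n powr - (\<sigma> + x)) summable_on UNIV"
      using abs_dirichlet_mono[OF b, of "\<sigma> + x"] x unfolding abs_dirichlet_def by simp
    from has_sum_mono[OF has_sum_infsum[OF this] has_sum_cmult_right[OF has_sum_infsum[OF b']] le]
    show ?thesis unfolding dirichlet_norm_def by simp
  qed
  have "((\<lambda>x :: real. 2 powr - x) \<longlongrightarrow> 0) at_top" by real_asymp
  then have "((\<lambda>x :: real. 2 powr - x * dirichlet_norm \<sigma> b) \<longlongrightarrow> 0) at_top"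
    by (rule tendsto_mult_left_zero)
  then have "\<forall>\<^sub>F x in at_top. 2 powr - x * dirichlet_norm \<sigma> b < e"
    using e by (rule order_tendstoD)
  then obtain x where "x \<ge> 0" "2 powr - x * dirichlet_norm \<sigma> b < e"
    using eventually_happens'[OF trivial_limit_at_top_linorder eventually_conj[OF _ eventually_ge_at_top[of 0]]] by blast
  then show ?thesis using that[of "\<sigma> + x"] *[of x] by simp
qed

section \<open>Littlewood's subordination principle for Dirichlet series\<close>

text \<open>The first \<open>N\<close> coefficients of \<open>\<psi> g\<close> depend only on the first \<open>N\<close> coefficients of \<open>g\<close>. So \<open>g\<close> may be
replaced by a Dirichlet polynomial, for which \<open>\<bar>\<psi> g\<bar> \<le> \<bar>g\<bar>\<close> holds on the whole half-plane; the bound for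
partial sums thereby extends to arbitrary formal \<open>g\<close>.\<close>

lemma multiplier_contraction:
  assumes b: "abs_dirichlet \<sigma> b \<psi>" and hol: "\<psi> holomorphic_on half_plane 0"
    and bd: "\<And>s. Re s > 0 \<Longrightarrow> norm (\<psi> s) \<le> 1"
  shows "(\<Sum>n=1..N. (norm (dconv b g n))\<^sup>2) \<le> (\<Sum>n=1..N. (norm (g n))\<^sup>2)"
proof -
  define g' where "g' n = (if n \<in> {1..N} then g n else 0)" for n
  define G where "G s = (\<Sum>n=1..N. g n * of_nat n powr - s)" for s :: complex
  define \<sigma>' where "\<sigma>' = max \<sigma> 1"
  have "((\<lambda>n. g' n * of_nat n powr - s) has_sum G s) UNIV" for s
    by (rule has_sum_finite_neutralI[of "{1..N}"]) (auto simp: g'_def G_def)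
  moreover have "(\<lambda>n. norm (g' n) * real n powr - \<sigma>') summable_on UNIV"
    by (rule has_sum_imp_summable[OF has_sum_finite_neutralI[of "{1..N}"]]) (auto simp: g'_def)
  ultimately have "abs_dirichlet \<sigma>' g' G" by (auto simp: abs_dirichlet_def g'_def)
  then have "abs_dirichlet \<sigma>' (dconv b g') (\<lambda>s. \<psi> s * G s)"
    by (intro abs_dirichlet_dconv abs_dirichlet_mono[OF b]) (auto simp: \<sigma>'_def)
  then have "(\<Sum>n=1..N. (norm (dconv b g' n))\<^sup>2) \<le> (\<Sum>n\<in>{1..N}. (norm (g n))\<^sup>2)"
  proof (rule coefficients_le_of_dominated)
    show "(\<lambda>s. \<psi> s * G s) holomorphic_on half_plane 0"
      unfolding G_def by (intro holomorphic_intros hol) auto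
    show "norm (\<psi> s * G s) \<le> norm (\<Sum>n=1..N. g n * of_nat n powr - s)" if "Re s > 0" for s
      using bd[OF that] mult_right_mono[OF bd[OF that], of "norm (G s)"] by (simp add: norm_mult G_def)
  qed (auto simp: \<sigma>'_def)
  also have "(\<Sum>n=1..N. (norm (dconv b g' n))\<^sup>2) = (\<Sum>n=1..N. (norm (dconv b g n))\<^sup>2)"
  proof (rule sum.cong[OF refl])
    fix n assume n: "n \<in> {1..N}"
    have "n div d \<in> {1..N}" if d: "d dvd n" for d
    proof -
      obtain e where e: "n = d * e" using d by (rule dvdE)
      then have "d \<ge> 1" "e \<ge> 1" using n by (auto simp: Suc_le_eq intro: Nat.gr0I)
      then have "n div d = e" "e \<le> d * e" using e by auto
      then show ?thesis using n e \<open>e \<ge> 1\<close>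
        by (metis atLeastAtMost_iff order.trans)
    qed
    then have "dconv b g' n = dconv b g n"
      unfolding dconv_def by (intro sum.cong) (auto simp: g'_def)
    then show "(norm (dconv b g' n))\<^sup>2 = (norm (dconv b g n))\<^sup>2" by simp
  qed
  finally show ?thesis .
qed

lemma dconv_sum_right:
  "dconv b (\<lambda>n. \<Sum>k\<in>A. a k * p k n) n = (\<Sum>k\<in>A. a k * dconv b (p k) n)"
  unfolding dconv_def sum_distrib_left
  by (subst sum.swap) (simp add: mult_ac)

text \<open>Littlewood's argument. With \<open>q\<close> the composition for the shifted coefficients, the series equals
\<open>a\<^sub>0 + \<psi> q\<close>. As \<open>b 1 = 0\<close>, the product has no constant term, so the two squared norms add up.\<close>

lemma dirichlet_subordination:
  assumes b: "b 1 = 0"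
    and mult: "\<And>g. (\<Sum>n=1..N. (norm (dconv b g n))\<^sup>2) \<le> (\<Sum>n=1..N. (norm (g n))\<^sup>2)"
  shows "(\<Sum>n=1..N. (norm (\<Sum>k<K. a k * dconv_pow b k n))\<^sup>2) \<le> (\<Sum>k<K. (norm (a k))\<^sup>2)"
proof (induction K arbitrary: a)
  case (Suc K)
  define q where "q = (\<lambda>n. \<Sum>k<K. a (Suc k) * dconv_pow b k n)"
  have split: "(\<Sum>k<Suc K. a k * dconv_pow b k n) = (if n = 1 then a 0 else 0) + dconv b q n" for n
    unfolding sum.lessThan_Suc_shift q_def by (simp add: dconv_sum_right)
  have "dconv b q 1 = 0" using b by (simp add: dconv_def)
  then have "(norm (\<Sum>k<Suc K. a k * dconv_pow b k n))\<^sup>2 =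
      (if n = 1 then (norm (a 0))\<^sup>2 else 0) + (norm (dconv b q n))\<^sup>2" for n
    unfolding split by auto
  then have "(\<Sum>n=1..N. (norm (\<Sum>k<Suc K. a k * dconv_pow b k n))\<^sup>2) =
      (\<Sum>n=1..N. if n = 1 then (norm (a 0))\<^sup>2 else 0) + (\<Sum>n=1..N. (norm (dconv b q n))\<^sup>2)"
    by (simp add: sum.distrib)
  also have "\<dots> \<le> (norm (a 0))\<^sup>2 + (\<Sum>n=1..N. (norm (q n))\<^sup>2)"
    by (intro add_mono mult) (simp add: sum.delta)
  also have "(\<Sum>n=1..N. (norm (q n))\<^sup>2) \<le> (\<Sum>k<K. (norm (a (Suc k)))\<^sup>2)"
    unfolding q_def by (rule Suc.IH)
  finally show ?case unfolding sum.lessThan_Suc_shift by simp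
qed simp

section \<open>Composition operators given by a definite description\<close>

lemma abs_dirichlet_holomorphic:
  assumes b: "abs_dirichlet \<sigma> b h"
  shows "h holomorphic_on half_plane \<sigma>"
proof (rule holomorphic_uniform_sequence[OF open_half_plane])
  let ?F = "\<lambda>N s. \<Sum>n<N. b n * of_nat n powr - s" and ?g = "\<lambda>n. norm (b n) * real n powr - \<sigma>"
  have "?F N = (\<lambda>s. \<Sum>n\<in>{..<N} - {0}. b n * of_nat n powr - s)" for N
    using b unfolding abs_dirichlet_def by (intro ext sum.mono_neutral_right) auto
  then show "?F N holomorphic_on half_plane \<sigma>" for N
    by (simp only:) (intro holomorphic_intros, auto)
  have unif: "uniform_limit (half_plane \<sigma>) ?F h sequentially"
    unfolding uniform_limit_iff
  proof (intro allI impI)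
    fix e :: real assume e: "e > 0"
    have "(\<lambda>N. suminf ?g - sum ?g {..<N}) \<longlonglongrightarrow> suminf ?g - suminf ?g"
      by (intro tendsto_intros summable_LIMSEQ abs_dirichlet_summable[OF b])
    then have "\<forall>\<^sub>F N in sequentially. suminf ?g - sum ?g {..<N} < e"
      using e by (intro order_tendstoD) auto
    then show "\<forall>\<^sub>F N in sequentially. \<forall>s\<in>half_plane \<sigma>. dist (?F N s) (h s) < e"
    proof (rule eventually_mono, intro ballI)
      fix N s assume "suminf ?g - sum ?g {..<N} < e" "s \<in> half_plane \<sigma>"
      then show "dist (?F N s) (h s) < e"
        using abs_dirichlet_tail_bound[OF b, of s N] by (simp add: dist_norm norm_minus_commute)
    qed
  qed
  fix s assume "s \<in> half_plane \<sigma>"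
  then obtain d where "d > 0" "cball s d \<subseteq> half_plane \<sigma>"
    using open_half_plane open_contains_cball by blast
  then show "\<exists>d>0. cball s d \<subseteq> half_plane \<sigma> \<and> uniform_limit (cball s d) ?F h sequentially"
    using uniform_limit_on_subset[OF unif] by blast
qed

text \<open>By \<open>2 x y \<le> x\<^sup>2 + y\<^sup>2\<close> applied to \<open>\<bar>a\<^sub>n\<bar>\<close> and \<open>n\<^sup>-\<^sup>\<sigma>\<close>, where \<open>2 \<sigma> > 1\<close>.\<close>

lemma abs_dirichlet_eval_h2:
  assumes "\<sigma> > 1/2"
  shows "abs_dirichlet \<sigma> (coeff_h2 f) (eval_h2 f)"
proof (rule abs_dirichletI)
  show "coeff_h2 f 0 = 0" using coeff_h2[of f] by simp
  have summ: "summable (\<lambda>n. norm (coeff_h2 f n) * real n powr - \<sigma>)"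
  proof (rule summable_comparison_test')
    show "summable (\<lambda>n. (norm (coeff_h2 f n))\<^sup>2 + real n powr (- (2 * \<sigma>)))"
      using assms by (intro summable_add summable_coeff_h2) (simp add: summable_real_powr_iff)
    fix n
    have "2 * (norm (coeff_h2 f n) * real n powr - \<sigma>) \<le> (norm (coeff_h2 f n))\<^sup>2 + (real n powr - \<sigma>)\<^sup>2"
      using sum_squares_bound[of "norm (coeff_h2 f n)" "real n powr - \<sigma>"] by (simp add: mult.assoc)
    moreover have "(real n powr - \<sigma>)\<^sup>2 = real n powr (- (2 * \<sigma>))"
      by (simp add: power2_eq_square flip: powr_add)
    moreover have "0 \<le> norm (coeff_h2 f n) * real n powr - \<sigma>" by simp
    ultimately show "norm (norm (coeff_h2 f n) * real n powr - \<sigma>) \<le> (norm (coeff_h2 f n))\<^sup>2 + real n powr (- (2 * \<sigma>))"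
      unfolding real_norm_def by linarith
  qed
  then show "summable (\<lambda>n. norm (coeff_h2 f n) * real n powr - \<sigma>)" .
  fix s :: complex assume s: "\<sigma> \<le> Re s"
  have "summable (\<lambda>n. coeff_h2 f n * of_nat n powr - s)"
    by (rule summable_comparison_test'[OF summ])
      (use s in \<open>simp add: norm_mult norm_nat_powr mult_left_mono nat_powr_antimono\<close>)
  then show "(\<lambda>n. coeff_h2 f n * of_nat n powr - s) sums eval_h2 f s"
    unfolding eval_h2_def by (rule summable_sums)
qed

lemma eval_h2_sums:
  assumes "Re s > 1/2"
  shows "(\<lambda>n. coeff_h2 f n * of_nat n powr - s) sums eval_h2 f s"
  using abs_dirichlet_sums[OF abs_dirichlet_eval_h2[OF assms]] by simp

lemma eval_h2_holomorphic: "eval_h2 f holomorphic_on half_plane (1/2)"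
proof -
  have "half_plane (1/2) = (\<Union>\<sigma>\<in>{1/2<..}. half_plane \<sigma>)"
  proof (intro set_eqI iffI)
    fix s assume "s \<in> half_plane (1/2)"
    then have "(1/2 + Re s) / 2 \<in> {1/2<..}" "s \<in> half_plane ((1/2 + Re s) / 2)" by (auto simp: field_simps)
    then show "s \<in> (\<Union>\<sigma>\<in>{1/2<..}. half_plane \<sigma>)" by blast
  qed auto
  then show ?thesis
    by (simp only:) (intro holomorphic_on_UN_open abs_dirichlet_holomorphic[OF abs_dirichlet_eval_h2] open_half_plane, auto)
qed

lemma abs_dirichlet_cong:
  assumes "abs_dirichlet \<sigma> b h" "\<And>s. \<sigma> \<le> Re s \<Longrightarrow> h s = k s"
  shows "abs_dirichlet \<sigma> b k"
  using assms unfolding abs_dirichlet_def by auto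

lemma eval_h2_inject:
  assumes "\<And>s. Re s > 1/2 \<Longrightarrow> eval_h2 f s = eval_h2 g s"
  shows "f = g"
proof -
  have "abs_dirichlet 1 (coeff_h2 f) (eval_h2 g)"
    by (rule abs_dirichlet_cong[OF abs_dirichlet_eval_h2]) (use assms in auto)
  then have "coeff_h2 f = coeff_h2 g"
    by (rule abs_dirichlet_unique) (rule abs_dirichlet_eval_h2, simp)
  then show ?thesis by (simp add: coeff_h2_inject)
qed

lemma comp_op_eqI:
  assumes "\<And>s. Re s > 1/2 \<Longrightarrow> eval_h2 g s = eval_h2 f (\<Phi> s)"
  shows "comp_op \<Phi> f = g"
  unfolding comp_op_def
proof (rule the_equality)
  fix g' assume "\<forall>s\<in>half_plane (1/2). eval_h2 g' s = eval_h2 f (\<Phi> s)"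
  then show "g' = g" using assms by (intro eval_h2_inject) auto
qed (use assms in auto)

lemma eval_h2_add:
  assumes "Re s > 1/2"
  shows "eval_h2 (f + g) s = eval_h2 f s + eval_h2 g s"
proof (rule sums_unique2[OF eval_h2_sums[OF assms]])
  show "(\<lambda>n. coeff_h2 (f + g) n * of_nat n powr - s) sums (eval_h2 f s + eval_h2 g s)"
    using sums_add[OF eval_h2_sums[OF assms, of f] eval_h2_sums[OF assms, of g]]
    by (simp add: plus_h2.rep_eq distrib_right)
qed

lemma eval_h2_scaleC:
  assumes "Re s > 1/2"
  shows "eval_h2 (scaleC_h2 c f) s = c * eval_h2 f s"
proof (rule sums_unique2[OF eval_h2_sums[OF assms]])
  show "(\<lambda>n. coeff_h2 (scaleC_h2 c f) n * of_nat n powr - s) sums (c * eval_h2 f s)"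
    using sums_mult[OF eval_h2_sums[OF assms, of f], of c]
    by (simp add: scaleC_h2.rep_eq mult.assoc)
qed

lift_definition one_h2 :: h2 is "\<lambda>n. if n = 1 then 1 else 0"
  by (auto intro!: summable_finite[of "{1}"] split: if_splits)

lemma eval_one_h2: "eval_h2 one_h2 s = 1"
proof -
  have "(\<Sum>n. coeff_h2 one_h2 n * of_nat n powr - s) = (\<Sum>n\<in>{1}. coeff_h2 one_h2 n * of_nat n powr - s)"
    by (rule suminf_finite) (auto simp: one_h2.rep_eq)
  then show ?thesis unfolding eval_h2_def by (simp add: one_h2.rep_eq)
qed

text \<open>The operator is a definite description, which takes one fixed junk value wherever \<open>f \<circ> \<Phi>\<close> is not
represented in the space. Linearity excludes this: if it happened at \<open>f\<close>, it would happen at \<open>2 f\<close> too,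
so the junk value would be \<open>0\<close>; it would also happen at \<open>1 + f\<close>, so the image of the constant \<open>1\<close>
would be \<open>0\<close>, but that image is \<open>1\<close>.\<close>

lemma comp_op_linear_imp_total:
  assumes lin: "Vector_Spaces.linear scaleC_h2 scaleC_h2 (comp_op \<Phi>)"
    and \<Phi>: "\<And>s. Re s > 1/2 \<Longrightarrow> Re (\<Phi> s) > 1/2" and s: "Re s > 1/2"
  shows "eval_h2 (comp_op \<Phi> f) s = eval_h2 f (\<Phi> s)"
proof -
  interpret Vector_Spaces.linear scaleC_h2 scaleC_h2 "comp_op \<Phi>" by (rule lin)
  define P where "P f g \<longleftrightarrow> (\<forall>s\<in>half_plane (1/2). eval_h2 g s = eval_h2 f (\<Phi> s))" for f g
  have junk: "comp_op \<Phi> f = (THE g. False)" if "\<nexists>g. P f g" for f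
  proof -
    have "(\<forall>s\<in>half_plane (1/2). eval_h2 g s = eval_h2 f (\<Phi> s)) = False" for g
      using that unfolding P_def by auto
    then show ?thesis unfolding comp_op_def by (simp only:)
  qed
  have one: "comp_op \<Phi> one_h2 = one_h2" by (rule comp_op_eqI) (simp add: eval_one_h2)
  have "\<exists>g. P f g"
  proof (rule ccontr)
    assume no: "\<nexists>g. P f g"
    have no2: "\<nexists>g. P (scaleC_h2 2 f) g"
    proof
      assume "\<exists>g. P (scaleC_h2 2 f) g"
      then obtain g where "P (scaleC_h2 2 f) g" by blast
      then have "P f (scaleC_h2 (1/2) g)" using \<Phi> by (simp add: P_def eval_h2_scaleC)
      then show False using no by blast
    qed
    have no3: "\<nexists>g. P (one_h2 + f) g"
    proof
      assume "\<exists>g. P (one_h2 + f) g"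
      then obtain g where "P (one_h2 + f) g" by blast
      then have "P f (g + scaleC_h2 (-1) one_h2)"
        using \<Phi> by (simp add: P_def eval_h2_scaleC eval_h2_add eval_one_h2 del: complex_h2.scale_minus_left)
      then show False using no by blast
    qed
    have "scaleC_h2 2 (comp_op \<Phi> f) = comp_op \<Phi> f"
      using scale[of 2 f] junk[OF no] junk[OF no2] by simp
    then have "comp_op \<Phi> f = 0"
      using complex_h2.scale_left_distrib[of 1 1 "comp_op \<Phi> f"] by simp
    then have "one_h2 = 0" using add[of one_h2 f] junk[OF no] junk[OF no3] one by simp
    then have "coeff_h2 one_h2 1 = coeff_h2 0 1" by simp
    then show False by (simp add: one_h2.rep_eq zero_h2.rep_eq)
  qed
  then obtain g where g: "P f g" ..
  then have "comp_op \<Phi> f = g" by (intro comp_op_eqI) (auto simp: P_def)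
  with g s show ?thesis by (simp add: P_def)
qed

section \<open>Factorization of the composition operator\<close>

lemma power_series_abs_summable:
  fixes a :: "nat \<Rightarrow> complex"
  assumes sums: "\<And>z. z \<in> ball w r \<Longrightarrow> (\<lambda>k. a k * (z - w) ^ k) sums F z" and x: "0 \<le> x" "x < r"
  shows "summable (\<lambda>k. norm (a k) * x ^ k)"
proof -
  obtain y where y: "x < y" "y < r" using x dense by blast
  have "w + of_real y \<in> ball w r" using x y by (simp add: dist_norm)
  then have "summable (\<lambda>k. a k * (of_real y) ^ k)"
    using sums[of "w + of_real y"] by (simp add: sums_iff)
  then have "summable (\<lambda>k. norm (a k * (of_real x) ^ k))"
    by (rule powser_insidea) (use x y in simp)
  then show ?thesis using x by (simp add: norm_mult norm_power)
qed

lemma nat_powr_power: "(of_nat (m ^ k) powr s :: complex) = (of_nat m powr s) ^ k"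
  by (induction k) (simp_all add: nat_powr_mult del: of_nat_power of_nat_mult)

text \<open>\<open>F (2\<^sup>-\<^sup>s)\<close> is the Dirichlet series supported on the powers of \<open>2\<close>, and coefficients are unique.\<close>

lemma coeff_h2_eq_taylor:
  assumes sums: "\<And>z. z \<in> ball 0 1 \<Longrightarrow> (\<lambda>k. a k * z ^ k) sums F z"
    and g: "\<And>s. Re s > 1/2 \<Longrightarrow> eval_h2 g s = F (2 powr - s)"
  shows "coeff_h2 g (2 ^ k) = a k"
proof -
  let ?p = "\<lambda>k. 2 ^ k :: nat"
  define \<beta> where "\<beta> n = (if n \<in> range ?p then a (inv ?p n) else 0)" for n
  have inj: "inj ?p" by (auto intro: injI)
  then have \<beta>: "\<beta> (?p k) = a k" for k by (simp add: \<beta>_def)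
  have "(\<lambda>k. norm (a k) * (1/2) ^ k) summable_on UNIV"
    using power_series_abs_summable[of 0 1 a F "1/2"] sums
    by (intro norm_summable_imp_summable_on) simp
  moreover have half: "real (2 ^ k) powr - 1 = (1/2) ^ k" for k
    by (simp add: powr_minus power_one_over inverse_eq_divide)
  ultimately have "((\<lambda>n. norm (\<beta> n) * real n powr - 1) \<circ> ?p) summable_on UNIV"
    by (simp only: o_def \<beta> half)
  then have summ: "(\<lambda>n. norm (\<beta> n) * real n powr - 1) summable_on UNIV"
    unfolding summable_on_reindex[OF inj, symmetric]
    by (subst (asm) summable_on_cong_neutral[where T = UNIV and g = "\<lambda>n. norm (\<beta> n) * real n powr - 1"])
      (auto simp: \<beta>_def)
  have "abs_dirichlet 1 \<beta> (\<lambda>s. F (2 powr - s))"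
    unfolding abs_dirichlet_def
  proof (intro conjI summ allI impI)
    show "\<beta> 0 = 0" by (auto simp: \<beta>_def)
    fix s :: complex assume s: "1 \<le> Re s"
    let ?z = "2 powr - s :: complex"
    have "norm ?z = 2 powr - Re s" using norm_nat_powr[of 2 "- s"] by simp
    also have "\<dots> \<le> 2 powr - 1" using s by (intro powr_mono) auto
    finally have z: "norm ?z \<le> 1/2" by (simp add: powr_minus)
    have "summable (\<lambda>k. norm (a k) * norm ?z ^ k)"
      using power_series_abs_summable[of 0 1 a F "norm ?z"] sums z by simp
    moreover have "(\<lambda>k. a k * ?z ^ k) sums F ?z" using sums z by simp
    ultimately have "((\<lambda>k. a k * ?z ^ k) has_sum F ?z) UNIV"
      by (intro norm_summable_imp_has_sum) (simp_all add: norm_mult norm_power)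
    moreover have "of_nat (2 ^ k) powr - s = ?z ^ k" for k
      using nat_powr_power[of 2 k "- s"] by simp
    ultimately have "((\<lambda>n. \<beta> n * of_nat n powr - s) \<circ> ?p has_sum F ?z) UNIV"
      by (simp only: o_def \<beta>)
    then show "((\<lambda>n. \<beta> n * of_nat n powr - s) has_sum F ?z) UNIV"
      unfolding has_sum_reindex[OF inj, symmetric]
      by (subst (asm) has_sum_cong_neutral[where T = UNIV and g = "\<lambda>n. \<beta> n * of_nat n powr - s"])
        (auto simp: \<beta>_def)
  qed
  moreover have "abs_dirichlet 1 (coeff_h2 g) (\<lambda>s. F (2 powr - s))"
    by (rule abs_dirichlet_cong[OF abs_dirichlet_eval_h2]) (use g in auto)
  ultimately show ?thesis using abs_dirichlet_unique \<beta> by metis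
qed

text \<open>The terms at a point of convergence are bounded; two units further right this gives the summable majorant
\<open>M n\<^sup>-\<^sup>2\<close>. Resetting the coefficient at \<open>0\<close> preserves the values since \<open>0 powr (- s) = 0\<close>.\<close>

lemma has_dirichlet_series_imp_abs:
  assumes "has_dirichlet_series h c"
  obtains \<sigma> where "abs_dirichlet \<sigma> (c(0 := 0)) h"
proof -
  obtain \<sigma> where \<sigma>: "\<And>s. s \<in> half_plane \<sigma> \<Longrightarrow> (\<lambda>n. c n * of_nat n powr - s) sums h s"
    using assms unfolding has_dirichlet_series_def by blast
  define \<tau> where "\<tau> = \<sigma> + 1"
  have "(\<lambda>n. c n * of_nat n powr - of_real \<tau>) sums h (of_real \<tau>)"
    by (rule \<sigma>) (simp add: \<tau>_def)
  then have "(\<lambda>n. c n * of_nat n powr - of_real \<tau>) \<longlonglongrightarrow> 0"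
    using summable_LIMSEQ_zero sums_summable by blast
  then have "Bseq (\<lambda>n. c n * of_nat n powr - of_real \<tau>)"
    using convergentI convergent_imp_Bseq by blast
  then obtain M where "M > 0" "\<And>n. norm (c n * of_nat n powr - of_real \<tau>) \<le> M"
    by (auto elim!: BseqE)
  then have M: "norm (c n) * real n powr - \<tau> \<le> M" "M > 0" for n
    by (simp_all add: norm_mult norm_nat_powr)
  have *: "(c(0 := 0)) n * of_nat n powr - s = c n * of_nat n powr - s" for n s by simp
  have "abs_dirichlet (\<tau> + 2) (c(0 := 0)) h"
  proof (rule abs_dirichletI)
    show "summable (\<lambda>n. norm ((c(0 := 0)) n) * real n powr - (\<tau> + 2))"
    proof (rule summable_comparison_test')
      show "summable (\<lambda>n. M * real n powr - 2)"
        by (intro summable_mult) (simp add: summable_real_powr_iff)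
      fix n
      have "norm ((c(0 := 0)) n) * real n powr - (\<tau> + 2) = (norm (c n) * real n powr - \<tau>) * real n powr - 2"
        by (simp flip: powr_add)
      also have "\<dots> \<le> M * real n powr - 2" using M by (intro mult_right_mono) auto
      finally show "norm (norm ((c(0 := 0)) n) * real n powr - (\<tau> + 2)) \<le> M * real n powr - 2" by simp
    qed
    show "(\<lambda>n. (c(0 := 0)) n * of_nat n powr - s) sums h s" if "\<tau> + 2 \<le> Re s" for s
      unfolding * using that by (intro \<sigma>) (simp add: \<tau>_def)
  qed simp
  then show ?thesis by (rule that)
qed

lemma abs_dirichlet_minus_const:
  assumes b: "abs_dirichlet \<sigma> b h"
  shows "abs_dirichlet \<sigma> (b(1 := 0)) (\<lambda>s. h s - b 1)"
  unfolding abs_dirichlet_def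
proof (intro conjI allI impI)
  show "(b(1 := 0)) 0 = 0" using b by (simp add: abs_dirichlet_def)
  have "(\<lambda>n. norm (b n) * real n powr - \<sigma>) summable_on UNIV" using b by (simp add: abs_dirichlet_def)
  then show "(\<lambda>n. norm ((b(1 := 0)) n) * real n powr - \<sigma>) summable_on UNIV"
    by (rule summable_on_comparison_test) auto
  fix s :: complex assume "\<sigma> \<le> Re s"
  then have 1: "((\<lambda>n. b n * of_nat n powr - s) has_sum h s) UNIV" using b by (simp add: abs_dirichlet_def)
  have 2: "((\<lambda>n. if n = 1 then - b 1 else 0) has_sum - b 1) UNIV"
    by (rule has_sum_finite_neutralI[of "{1}"]) auto
  have "b n * of_nat n powr - s + (if n = 1 then - b 1 else 0) = (b(1 := 0)) n * of_nat n powr - s" for n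
    by simp
  then show "((\<lambda>n. (b(1 := 0)) n * of_nat n powr - s) has_sum h s - b 1) UNIV"
    using has_sum_add[OF 1 2] by simp
qed

text \<open>Far to the right \<open>\<phi>\<close> stays in a disk around \<open>c 1\<close> on which \<open>G\<close> is given by its Taylor series, so the
Taylor series can be composed with the Dirichlet series of \<open>\<phi> - c 1\<close>.\<close>

lemma abs_dirichlet_holomorphic_image:
  assumes \<phi>: "has_dirichlet_series \<phi> c" and D: "open D" "c 1 \<in> D"
    and G: "G holomorphic_on D" "G (c 1) = 0"
  obtains \<sigma> b where "abs_dirichlet \<sigma> b (\<lambda>s. G (\<phi> s))" "b 1 = 0"
proof -
  obtain \<sigma> where "abs_dirichlet \<sigma> (c(0 := 0)) \<phi>" using has_dirichlet_series_imp_abs[OF \<phi>] .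
  define e where "e = c(0 := 0, 1 := 0)"
  have e: "abs_dirichlet \<sigma> e (\<lambda>s. \<phi> s - c 1)"
    using abs_dirichlet_minus_const[OF \<open>abs_dirichlet \<sigma> (c(0 := 0)) \<phi>\<close>] by (simp add: e_def)
  obtain r where r: "r > 0" "ball (c 1) r \<subseteq> D" using D openE by blast
  obtain \<sigma>' where \<sigma>': "\<sigma> \<le> \<sigma>'" "dirichlet_norm \<sigma>' e < r"
    using dirichlet_norm_small[OF e _ r(1)] by (auto simp: e_def)
  have e': "abs_dirichlet \<sigma>' e (\<lambda>s. \<phi> s - c 1)" by (rule abs_dirichlet_mono[OF e \<sigma>'(1)])
  define a where "a k = (deriv ^^ k) G (c 1) / fact k" for k
  have G': "G holomorphic_on ball (c 1) r" using G r holomorphic_on_subset by blast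
  have a: "(\<lambda>k. a k * (z - c 1) ^ k) sums G z" if "z \<in> ball (c 1) r" for z
    using holomorphic_power_series[OF G' that] by (simp add: a_def)
  have "abs_dirichlet \<sigma>' (dirichlet_compose a e) (\<lambda>s. \<Sum>k. a k * (\<phi> s - c 1) ^ k)"
    by (rule abs_dirichlet_compose[OF e' _ power_series_abs_summable[OF a]])
      (use \<sigma>' in \<open>auto simp: e_def dirichlet_norm_nonneg\<close>)
  then have "abs_dirichlet \<sigma>' (dirichlet_compose a e) (\<lambda>s. G (\<phi> s))"
  proof (rule abs_dirichlet_cong)
    fix s assume "\<sigma>' \<le> Re s"
    then have "norm (\<phi> s - c 1) < r" using abs_dirichlet_norm_bound[OF e', of s] \<sigma>' by simp
    then have "\<phi> s \<in> ball (c 1) r" by (simp add: dist_norm norm_minus_commute)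
    from a[OF this] show "(\<Sum>k. a k * (\<phi> s - c 1) ^ k) = G (\<phi> s)" by (simp add: sums_iff)
  qed
  moreover have "dirichlet_compose a e 1 = 0"
    using G by (simp add: dirichlet_compose_def dconv_def a_def e_def)
  ultimately show ?thesis by (rule that)
qed

text \<open>The operator \<open>\<Sum>k. a\<^sub>k 2\<^sup>-\<^sup>k\<^sup>s \<mapsto> \<Sum>k. a\<^sub>k \<psi>\<^sup>k\<close>, extended by first projecting onto the series supported on the
powers of \<open>2\<close>.\<close>

definition subordination_op :: "(nat \<Rightarrow> complex) \<Rightarrow> h2 \<Rightarrow> h2" where
  "subordination_op b g = Abs_h2 (dirichlet_compose (\<lambda>k. coeff_h2 g (2 ^ k)) b)"

lemma sum_coeff_powers_of_2_le: "(\<Sum>k<K. (norm (coeff_h2 g (2 ^ k)))\<^sup>2) \<le> (norm g)\<^sup>2"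
proof -
  have inj: "inj_on (\<lambda>k. 2 ^ k :: nat) {..<K}" by (auto intro: inj_onI)
  have "(\<Sum>k<K. (norm (coeff_h2 g (2 ^ k)))\<^sup>2) = (\<Sum>n\<in>(\<lambda>k. 2 ^ k) ` {..<K}. (norm (coeff_h2 g n))\<^sup>2)"
    by (simp add: sum.reindex[OF inj])
  also have "\<dots> \<le> (\<Sum>n. (norm (coeff_h2 g n))\<^sup>2)"
    by (intro sum_le_suminf summable_coeff_h2) auto
  also have "\<dots> = (norm g)\<^sup>2"
    unfolding norm_h2_def by (simp add: suminf_nonneg summable_coeff_h2)
  finally show ?thesis .
qed

text \<open>The functions \<open>\<psi>\<close> that may be substituted for \<open>2\<^sup>-\<^sup>s\<close>: like it, they map \<open>half_plane 0\<close> into the closed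
unit disk and tend to \<open>0\<close> far to the right. The theorem uses \<open>\<psi> = R\<inverse> \<circ> \<phi>\<close>.\<close>

locale contractive_symbol =
  fixes b :: "nat \<Rightarrow> complex" and \<psi> :: "complex \<Rightarrow> complex" and \<sigma> :: real
  assumes series: "abs_dirichlet \<sigma> b \<psi>" and vanishing: "b 1 = 0"
    and hol: "\<psi> holomorphic_on half_plane 0" and bounded: "\<And>s. Re s > 0 \<Longrightarrow> norm (\<psi> s) \<le> 1"
begin

lemma b_0: "b 0 = 0" using series by (simp add: abs_dirichlet_def)

lemma partial_sums_le:
  "(\<Sum>n<N. (norm (dirichlet_compose (\<lambda>k. coeff_h2 g (2 ^ k)) b n))\<^sup>2) \<le> (norm g)\<^sup>2"
proof -
  let ?c = "dirichlet_compose (\<lambda>k. coeff_h2 g (2 ^ k)) b"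
  let ?q = "\<lambda>n. \<Sum>k<Suc N. coeff_h2 g (2 ^ k) * dconv_pow b k n"
  have c0: "?c 0 = 0" by (simp add: dirichlet_compose_def)
  have "(\<Sum>n<N. (norm (?c n))\<^sup>2) \<le> (\<Sum>n\<in>{0..N}. (norm (?c n))\<^sup>2)"
    by (rule sum_mono2) auto
  also have "\<dots> = (\<Sum>n=1..N. (norm (?c n))\<^sup>2)"
    using c0 by (intro sum.mono_neutral_right) (auto simp: Suc_le_eq intro: Nat.gr0I)
  also have "\<dots> = (\<Sum>n=1..N. (norm (?q n))\<^sup>2)"
    by (intro sum.cong refl) (subst dirichlet_compose_eq[where K = "Suc N", OF b_0 vanishing], auto)
  also have "\<dots> \<le> (\<Sum>k<Suc N. (norm (coeff_h2 g (2 ^ k)))\<^sup>2)"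
    by (intro dirichlet_subordination vanishing multiplier_contraction[OF series hol bounded])
  also have "\<dots> \<le> (norm g)\<^sup>2" by (rule sum_coeff_powers_of_2_le)
  finally show ?thesis .
qed

lemma coeff_subordination_op:
  "coeff_h2 (subordination_op b g) = dirichlet_compose (\<lambda>k. coeff_h2 g (2 ^ k)) b"
  unfolding subordination_op_def
proof (rule Abs_h2_inverse, rule CollectI, rule conjI)
  show "summable (\<lambda>n. (norm (dirichlet_compose (\<lambda>k. coeff_h2 g (2 ^ k)) b n))\<^sup>2)"
    by (rule summableI_nonneg_bounded[OF _ partial_sums_le]) simp
qed (simp add: dirichlet_compose_def)

lemma norm_subordination_op_le: "norm (subordination_op b g) \<le> norm g"
proof -
  have "(norm (subordination_op b g))\<^sup>2 = (\<Sum>n. (norm (coeff_h2 (subordination_op b g) n))\<^sup>2)"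
    unfolding norm_h2_def by (simp add: suminf_nonneg summable_coeff_h2)
  also have "\<dots> \<le> (norm g)\<^sup>2"
    unfolding coeff_subordination_op
    by (rule suminf_le_const[OF summable_coeff_h2[of "subordination_op b g", unfolded coeff_subordination_op] partial_sums_le])
  finally show ?thesis by (rule power2_le_imp_le) simp
qed

lemma linear_subordination_op: "Vector_Spaces.linear scaleC_h2 scaleC_h2 (subordination_op b)"
proof unfold_locales
  fix f g :: h2 and r :: complex
  show "subordination_op b (f + g) = subordination_op b f + subordination_op b g"
    by (simp add: coeff_h2_inject[symmetric] plus_h2.rep_eq coeff_subordination_op fun_eq_iff
        dirichlet_compose_def distrib_right sum.distrib)
  show "subordination_op b (scaleC_h2 r f) = scaleC_h2 r (subordination_op b f)"
    by (simp add: coeff_h2_inject[symmetric] scaleC_h2.rep_eq coeff_subordination_op fun_eq_iff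
        dirichlet_compose_def sum_distrib_left mult.assoc)
qed

lemma eval_subordination_op:
  assumes sums: "\<And>z. z \<in> ball 0 1 \<Longrightarrow> (\<lambda>k. coeff_h2 g (2 ^ k) * z ^ k) sums F z"
  obtains \<sigma>' where "\<And>s. \<sigma>' \<le> Re s \<Longrightarrow> eval_h2 (subordination_op b g) s = F (\<psi> s)"
proof -
  let ?a = "\<lambda>k. coeff_h2 g (2 ^ k)"
  obtain \<sigma>' where \<sigma>': "\<sigma> \<le> \<sigma>'" "dirichlet_norm \<sigma>' b < 1"
    using dirichlet_norm_small[OF series vanishing, of 1] by auto
  have b': "abs_dirichlet \<sigma>' b \<psi>" by (rule abs_dirichlet_mono[OF series \<sigma>'(1)])
  have "summable (\<lambda>k. norm (?a k) * dirichlet_norm \<sigma>' b ^ k)"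
    using power_series_abs_summable[of 0 1 ?a F] sums \<sigma>'(2) dirichlet_norm_nonneg by simp
  from abs_dirichlet_compose[OF b' vanishing this]
  have comp: "abs_dirichlet \<sigma>' (coeff_h2 (subordination_op b g)) (\<lambda>s. \<Sum>k. ?a k * \<psi> s ^ k)"
    by (simp add: coeff_subordination_op)
  show ?thesis
  proof
    fix s assume s: "max \<sigma>' 1 \<le> Re s"
    have "norm (\<psi> s) < 1" using abs_dirichlet_norm_bound[OF b', of s] \<sigma>' s by simp
    then have "(\<Sum>k. ?a k * \<psi> s ^ k) = F (\<psi> s)" using sums[of "\<psi> s"] by (simp add: sums_iff)
    moreover have "eval_h2 (subordination_op b g) s = (\<Sum>k. ?a k * \<psi> s ^ k)"
      using s by (intro sums_unique2[OF eval_h2_sums abs_dirichlet_sums[OF comp]]) auto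
    ultimately show "eval_h2 (subordination_op b g) s = F (\<psi> s)" by simp
  qed
qed

end

text \<open>Far to the right the equality is a rearrangement of a double series; the identity theorem carries it to \<open>half_plane (1/2)\<close>, where \<open>comp_op\<close> tests it.\<close>

theorem comp_op_factorization:
  assumes phi: "\<phi> \<in> GH0"
    and coeffs: "has_dirichlet_series \<phi> c"
    and D: "open D" "D \<subseteq> half_plane (1/2)"
    and range: "\<phi> ` half_plane 0 \<subseteq> D"
    and riemann: "R holomorphic_on ball 0 1" "inj_on R (ball 0 1)" "R ` ball 0 1 = D"
    and R0: "R 0 = c 1"
    and lin: "Vector_Spaces.linear scaleC_h2 scaleC_h2 (comp_op (\<lambda>s. R (2 powr (- s))))"
  obtains T where "Vector_Spaces.linear scaleC_h2 scaleC_h2 T" "\<And>g. norm (T g) \<le> norm g"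
    "comp_op \<phi> = (\<lambda>f. T (comp_op (\<lambda>s. R (2 powr (- s))) f))"
proof -
  obtain G where G: "G holomorphic_on D" "\<And>z. z \<in> ball 0 1 \<Longrightarrow> G (R z) = z"
    using holomorphic_has_inverse[OF riemann(1) open_ball riemann(2)] riemann(3) by metis
  have "R 0 \<in> R ` ball 0 1" by (rule imageI) simp
  then have c1: "c 1 \<in> D" using riemann(3) R0 by simp
  have Gc: "G (c 1) = 0" using G(2)[of 0] R0 by simp
  have RG: "R (G w) = w" "norm (G w) < 1" if "w \<in> D" for w
    using that G(2) unfolding riemann(3)[symmetric] by auto
  have \<phi>: "\<phi> s \<in> D" if "Re s > 0" for s using range that by auto
  have phi_hol: "\<phi> holomorphic_on half_plane 0" using phi by (simp add: GH0_def)
  obtain \<sigma> b where b: "abs_dirichlet \<sigma> b (\<lambda>s. G (\<phi> s))" "b 1 = 0"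
    using abs_dirichlet_holomorphic_image[OF coeffs D(1) c1 G(1) Gc] .
  have "(G \<circ> \<phi>) holomorphic_on half_plane 0"
    by (rule holomorphic_on_compose_gen[OF phi_hol G(1) range])
  then interpret contractive_symbol b "\<lambda>s. G (\<phi> s)" \<sigma>
    using b RG(2) \<phi> by unfold_locales (auto simp: o_def intro!: less_imp_le)
  define \<Phi> where "\<Phi> s = R (2 powr (- s))" for s
  have disc: "(2 powr - s :: complex) \<in> ball 0 1" if "Re s > 0" for s
    using that norm_nat_powr[of 2 "- s"] powr_less_mono[of "- Re s" 0 2] by simp
  have \<Phi>: "Re (\<Phi> s) > 1/2" if "Re s > 1/2" for s
    using disc[of s] that riemann(3) D(2) unfolding \<Phi>_def by fastforce
  have "comp_op \<phi> f = subordination_op b (comp_op \<Phi> f)" for f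
  proof (rule comp_op_eqI)
    define g where "g = comp_op \<Phi> f"
    define F where "F z = eval_h2 f (R z)" for z
    have "F holomorphic_on ball 0 1"
      using holomorphic_on_compose_gen[OF riemann(1) eval_h2_holomorphic[of f]] riemann(3) D(2)
      by (simp add: F_def[abs_def] o_def)
    then have F: "(\<lambda>k. (deriv ^^ k) F 0 / fact k * z ^ k) sums F z" if "z \<in> ball 0 1" for z
      using holomorphic_power_series[OF _ that] by fastforce
    have "eval_h2 g s = F (2 powr - s)" if "Re s > 1/2" for s
      using comp_op_linear_imp_total[OF lin[folded \<Phi>_def] \<Phi> that, of f] by (simp add: g_def F_def) (simp add: \<Phi>_def)
    from coeff_h2_eq_taylor[OF F this]
    have "(\<lambda>k. coeff_h2 g (2 ^ k) * z ^ k) sums F z" if "z \<in> ball 0 1" for z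
      using F[OF that] by simp
    from eval_subordination_op[OF this]
    obtain \<sigma>' where \<sigma>': "\<And>s. \<sigma>' \<le> Re s \<Longrightarrow> eval_h2 (subordination_op b g) s = F (G (\<phi> s))" by blast
    fix s :: complex assume s: "Re s > 1/2"
    let ?S = "half_plane (max \<sigma>' 1)"
    have "of_real (max \<sigma>' 1 + 1) \<in> ?S" by (auto simp: max_def)
    then have ne: "?S \<noteq> {}" by blast
    have hol2: "(\<lambda>s. eval_h2 f (\<phi> s)) holomorphic_on half_plane (1/2)"
    proof -
      have "(eval_h2 f \<circ> \<phi>) holomorphic_on half_plane (1/2)"
      proof (rule holomorphic_on_compose_gen[OF _ eval_h2_holomorphic])
        show "\<phi> holomorphic_on half_plane (1/2)"
          by (rule holomorphic_on_subset[OF phi_hol]) auto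
        show "\<phi> ` half_plane (1/2) \<subseteq> half_plane (1/2)"
        proof safe
          fix z :: complex assume "1/2 < Re z"
          then show "1/2 < Re (\<phi> z)" using \<phi>[of z] D(2) by auto
        qed
      qed
      then show ?thesis by (simp add: o_def)
    qed
    show "eval_h2 (subordination_op b (comp_op \<Phi> f)) s = eval_h2 f (\<phi> s)"
      unfolding g_def[symmetric]
    proof (rule analytic_continuation_open[OF open_half_plane open_half_plane ne _ _ eval_h2_holomorphic hol2])
      show "connected (half_plane (1/2))" by (intro convex_connected convex_half_plane)
      show "eval_h2 (subordination_op b g) z = eval_h2 f (\<phi> z)" if "z \<in> ?S" for z
        using that \<sigma>'[of z] RG(1)[OF \<phi>, of z] by (simp add: F_def)
    qed (use s in auto)
  qed
  then show ?thesis
    by (intro that[of "subordination_op b"] linear_subordination_op norm_subordination_op_le)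
      (simp add: fun_eq_iff \<Phi>_def[abs_def])
qed

section \<open>Inner product and adjoints\<close>

abbreviation clinear_h2 :: "(h2 \<Rightarrow> h2) \<Rightarrow> bool" where
  "clinear_h2 \<equiv> Vector_Spaces.linear scaleC_h2 scaleC_h2"

lemma clinear_h2D:
  assumes "clinear_h2 T"
  shows "T (f + g) = T f + T g" "T (scaleC_h2 c f) = scaleC_h2 c (T f)" "T 0 = 0"
    "T (f - g) = T f - T g" "T (\<Sum>i\<in>I. h i) = (\<Sum>i\<in>I. T (h i))"
proof -
  interpret Vector_Spaces.linear scaleC_h2 scaleC_h2 T by (rule assms)
  show "T (f + g) = T f + T g" "T (scaleC_h2 c f) = scaleC_h2 c (T f)" "T 0 = 0"
    "T (f - g) = T f - T g" "T (\<Sum>i\<in>I. h i) = (\<Sum>i\<in>I. T (h i))"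
    by (rule add scale zero diff sum)+
qed

lemma scaleR_eq_scaleC: "r *\<^sub>R f = scaleC_h2 (of_real r) f"
  by (simp add: coeff_h2_inject[symmetric] scaleR_h2.rep_eq scaleC_h2.rep_eq fun_eq_iff)

lemma cinner_add_left: "cinner_h2 (f + g) h = cinner_h2 f h + cinner_h2 g h"
  unfolding cinner_h2_def
  by (simp add: suminf_add[OF summable_cinner_h2 summable_cinner_h2] plus_h2.rep_eq distrib_right)

lemma cinner_scaleC_left: "cinner_h2 (scaleC_h2 c f) h = c * cinner_h2 f h"
  unfolding cinner_h2_def
  by (simp add: suminf_mult[OF summable_cinner_h2, symmetric] scaleC_h2.rep_eq mult.assoc)

lemma cinner_commute: "cinner_h2 g f = cnj (cinner_h2 f g)"
  unfolding cinner_h2_def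
  by (simp add: bounded_linear.suminf[OF bounded_linear_cnj summable_cinner_h2] mult.commute)

lemma cinner_add_right: "cinner_h2 h (f + g) = cinner_h2 h f + cinner_h2 h g"
  by (metis cinner_add_left cinner_commute complex_cnj_add)

lemma cinner_scaleC_right: "cinner_h2 h (scaleC_h2 c f) = cnj c * cinner_h2 h f"
  by (metis cinner_scaleC_left cinner_commute complex_cnj_mult)

lemma cinner_zero [simp]: "cinner_h2 0 f = 0" "cinner_h2 f 0 = 0"
  unfolding cinner_h2_def by (simp_all add: zero_h2.rep_eq)

lemma cinner_diff_left: "cinner_h2 (f - g) h = cinner_h2 f h - cinner_h2 g h"
  using cinner_add_left[of "f - g" g h] by simp

lemma cinner_diff_right: "cinner_h2 h (f - g) = cinner_h2 h f - cinner_h2 h g"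
  using cinner_add_right[of h "f - g" g] by simp

lemma cinner_sum_left: "cinner_h2 (\<Sum>i\<in>I. f i) h = (\<Sum>i\<in>I. cinner_h2 (f i) h)"
  by (induction I rule: infinite_finite_induct) (simp_all add: cinner_add_left)

lemma cinner_sum_right: "cinner_h2 h (\<Sum>i\<in>I. f i) = (\<Sum>i\<in>I. cinner_h2 h (f i))"
  by (induction I rule: infinite_finite_induct) (simp_all add: cinner_add_right)

lemma Re_cinner: "Re (cinner_h2 f g) = f \<bullet> g"
  by (simp add: inner_h2_def)

lemma cinner_self: "cinner_h2 f f = of_real ((norm f)\<^sup>2)"
proof (rule complex_eqI)
  show "Re (cinner_h2 f f) = Re (of_real ((norm f)\<^sup>2))" by (simp add: Re_cinner power2_norm_eq_inner)
  have "Im (cinner_h2 f f) = - Im (cinner_h2 f f)"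
    by (metis cinner_commute complex_cnj cnj.sel(2))
  then show "Im (cinner_h2 f f) = Im (of_real ((norm f)\<^sup>2))" by simp
qed

lemma norm_scaleC: "norm (scaleC_h2 c f) = norm c * norm f"
proof -
  have "complex_of_real ((norm (scaleC_h2 c f))\<^sup>2) = of_real ((norm c * norm f)\<^sup>2)"
    unfolding power_mult_distrib of_real_mult cinner_self[symmetric] complex_norm_square
    by (simp add: cinner_scaleC_left cinner_scaleC_right)
  then have "(norm (scaleC_h2 c f))\<^sup>2 = (norm c * norm f)\<^sup>2" unfolding of_real_eq_iff .
  then show ?thesis by (rule power2_eq_imp_eq) simp_all
qed

text \<open>The real Cauchy-Schwarz inequality, after rotating \<open>f\<close> so that the inner product becomes nonnegative.\<close>

lemma norm_cinner_le: "norm (cinner_h2 f g) \<le> norm f * norm g"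
proof (cases "cinner_h2 f g = 0")
  case False
  define u where "u = cnj (cinner_h2 f g) / of_real (norm (cinner_h2 f g))"
  have u: "norm u = 1" using False by (simp add: u_def norm_divide)
  have "u * cinner_h2 f g = of_real (norm (cinner_h2 f g))"
    using False complex_norm_square[of "cinner_h2 f g"]
    by (simp add: u_def divide_simps power2_eq_square mult.commute)
  then have "norm (cinner_h2 f g) = scaleC_h2 u f \<bullet> g"
    by (simp add: Re_cinner[symmetric] cinner_scaleC_left)
  also have "\<dots> \<le> norm (scaleC_h2 u f) * norm g" by (rule norm_cauchy_schwarz)
  finally show ?thesis by (simp add: norm_scaleC u)
qed simp

lemma bounded_linear_cinner: "bounded_linear (\<lambda>f. cinner_h2 f g)"
proof (rule bounded_linear_intro[where K = "norm g"])
  show "cinner_h2 (r *\<^sub>R f) g = r *\<^sub>R cinner_h2 f g" for r f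
    by (simp add: scaleR_eq_scaleC cinner_scaleC_left scaleR_conv_of_real)
qed (simp_all add: cinner_add_left norm_cinner_le)

lemma tendsto_scaleC:
  assumes "(f \<longlongrightarrow> l) F"
  shows "((\<lambda>x. scaleC_h2 c (f x)) \<longlongrightarrow> scaleC_h2 c l) F"
proof (rule bounded_linear.tendsto[OF _ assms], rule bounded_linear_intro[where K = "norm c"])
  show "scaleC_h2 c (r *\<^sub>R f) = r *\<^sub>R scaleC_h2 c f" for r f
    by (simp add: scaleR_eq_scaleC mult.commute)
qed (simp_all add: norm_scaleC complex_h2.scale_right_distrib mult.commute)

lemma h2_eqI: "(\<And>f. cinner_h2 f g = cinner_h2 f h) \<Longrightarrow> g = h"
  using cinner_self[of "g - h"] by (simp add: cinner_diff_right)

lift_definition unit_h2 :: "nat \<Rightarrow> h2" is "\<lambda>n m. if m = n \<and> n \<noteq> 0 then 1 else 0"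
  by (auto intro!: summable_finite[of "{_}"] split: if_splits)

lemma coeff_h2_0: "coeff_h2 f 0 = 0"
  using coeff_h2[of f] by simp

lemma coeff_sum_h2: "coeff_h2 (\<Sum>i\<in>I. f i) n = (\<Sum>i\<in>I. coeff_h2 (f i) n)"
  by (induction I rule: infinite_finite_induct) (simp_all add: zero_h2.rep_eq plus_h2.rep_eq)

lemma norm_h2_square: "(norm f)\<^sup>2 = (\<Sum>n. (norm (coeff_h2 f n))\<^sup>2)"
  unfolding norm_h2_def by (simp add: suminf_nonneg summable_coeff_h2)

lemma coeff_unit_sum:
  assumes "c 0 = 0"
  shows "coeff_h2 (\<Sum>n<N. scaleC_h2 (c n) (unit_h2 n)) m = (if m < N then c m else 0)"
proof -
  have "coeff_h2 (\<Sum>n<N. scaleC_h2 (c n) (unit_h2 n)) m = (\<Sum>n<N. if n = m then c m else 0)"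
    unfolding coeff_sum_h2 scaleC_h2.rep_eq unit_h2.rep_eq using assms by (intro sum.cong) auto
  then show ?thesis by simp
qed

lemma sums_unit_h2: "(\<lambda>n. scaleC_h2 (coeff_h2 f n) (unit_h2 n)) sums f"
proof -
  let ?s = "\<lambda>N. \<Sum>n<N. scaleC_h2 (coeff_h2 f n) (unit_h2 n)" and ?g = "\<lambda>n. (norm (coeff_h2 f n))\<^sup>2"
  have "(norm (?s N - f))\<^sup>2 = suminf ?g - sum ?g {..<N}" for N
  proof -
    have "(norm (?s N - f))\<^sup>2 = (\<Sum>n. if n < N then 0 else ?g n)"
      unfolding norm_h2_square minus_h2.rep_eq coeff_unit_sum[where c = "coeff_h2 f", OF coeff_h2_0]
      by (intro suminf_cong) auto
    also have "\<dots> = (\<Sum>n. (if n + N < N then 0 else ?g (n + N))) + (\<Sum>n<N. if n < N then 0 else ?g n)"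
      by (rule suminf_split_initial_segment)
        (rule summable_comparison_test'[OF summable_coeff_h2[of f]], simp)
    also have "\<dots> = (\<Sum>n. ?g (n + N))" by simp
    finally show ?thesis
      by (simp add: suminf_minus_initial_segment[OF summable_coeff_h2])
  qed
  moreover have "(\<lambda>N. suminf ?g - sum ?g {..<N}) \<longlonglongrightarrow> suminf ?g - suminf ?g"
    by (intro tendsto_intros summable_LIMSEQ summable_coeff_h2)
  ultimately have "(\<lambda>N. (norm (?s N - f))\<^sup>2) \<longlonglongrightarrow> 0" by simp
  then have "(\<lambda>N. sqrt ((norm (?s N - f))\<^sup>2)) \<longlonglongrightarrow> sqrt 0" by (rule tendsto_real_sqrt)
  then have "(\<lambda>N. norm (?s N - f)) \<longlonglongrightarrow> 0" by simp
  then show ?thesis unfolding sums_def by (simp add: LIM_zero_iff tendsto_norm_zero_iff)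
qed

lemma square_le_imp_le: "(a::real) * a \<le> K * a \<Longrightarrow> 0 \<le> a \<Longrightarrow> 0 \<le> K \<Longrightarrow> a \<le> K"
  by (cases "a = 0") auto

text \<open>The adjoint is written down in coordinates: \<open>S g\<close> has the coefficients \<open>\<langle>g, A e\<^sub>n\<rangle>\<close>. They are square
summable, because testing \<open>A\<close> on their truncations \<open>h\<close> gives \<open>\<parallel>h\<parallel>\<^sup>2 \<le> K \<parallel>h\<parallel> \<parallel>g\<parallel>\<close>.\<close>

lemma adjoint_exists:
  assumes lin: "clinear_h2 A" and bd: "\<And>f. norm (A f) \<le> K * norm f"
  shows "\<exists>S. \<forall>f g. cinner_h2 (A f) g = cinner_h2 f (S g)"
proof -
  have K: "0 \<le> K * norm f" for f :: h2 by (rule order.trans[OF norm_ge_zero bd])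
  have "\<exists>h. \<forall>f. cinner_h2 (A f) g = cinner_h2 f h" for g
  proof -
    define c where "c n = cinner_h2 g (A (unit_h2 n))" for n
    have c0: "c 0 = 0"
    proof -
      have "unit_h2 0 = 0" by (simp add: coeff_h2_inject[symmetric] unit_h2.rep_eq zero_h2.rep_eq fun_eq_iff)
      then show ?thesis by (simp add: c_def clinear_h2D[OF lin])
    qed
    have "(\<Sum>n<N. (norm (c n))\<^sup>2) \<le> (K * norm g)\<^sup>2" for N
    proof -
      define h where "h = (\<Sum>n<N. scaleC_h2 (c n) (unit_h2 n))"
      have "(norm h)\<^sup>2 = (\<Sum>n. if n < N then (norm (c n))\<^sup>2 else 0)"
        unfolding norm_h2_square h_def coeff_unit_sum[of c, OF c0] by (intro suminf_cong) auto
      also have "\<dots> = (\<Sum>n<N. if n < N then (norm (c n))\<^sup>2 else 0)"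
        by (rule suminf_finite) auto
      finally have h: "(norm h)\<^sup>2 = (\<Sum>n<N. (norm (c n))\<^sup>2)" by simp
      have "cinner_h2 (A h) g = (\<Sum>n<N. c n * cnj (c n))"
        unfolding h_def clinear_h2D[OF lin] cinner_sum_left cinner_scaleC_left c_def
        by (simp add: cinner_commute[of "A _" g])
      also have "\<dots> = of_real ((norm h)\<^sup>2)" unfolding h of_real_sum complex_norm_square by simp
      finally have "(norm h)\<^sup>2 = norm (cinner_h2 (A h) g)" by (simp add: norm_power)
      also have "\<dots> \<le> norm (A h) * norm g" by (rule norm_cinner_le)
      also have "\<dots> \<le> K * norm h * norm g" by (intro mult_right_mono bd) simp
      finally have "norm h \<le> K * norm g"
        using square_le_imp_le[of "norm h" "K * norm g"] K by (simp add: power2_eq_square mult_ac)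
      then show ?thesis unfolding h[symmetric] by (intro power_mono) simp_all
    qed
    then have "summable (\<lambda>n. (norm (c n))\<^sup>2)" by (intro summableI_nonneg_bounded) auto
    then have c: "coeff_h2 (Abs_h2 c) = c" using c0 by (intro Abs_h2_inverse) auto
    have "cinner_h2 (A f) g = cinner_h2 f (Abs_h2 c)" for f
    proof -
      have "bounded_linear A"
      proof (rule bounded_linear_intro[where K = K])
        show "norm (A f) \<le> norm f * K" for f using bd[of f] by (simp only: mult.commute)
      qed (simp_all add: clinear_h2D[OF lin] scaleR_eq_scaleC)
      from bounded_linear.sums[OF bounded_linear_cinner[of g] bounded_linear.sums[OF this sums_unit_h2[of f]]]
      have "(\<lambda>n. coeff_h2 f n * cnj (c n)) sums cinner_h2 (A f) g"
        by (simp add: clinear_h2D[OF lin] cinner_scaleC_left c_def cinner_commute[of "A _" g])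
      then show ?thesis unfolding cinner_h2_def[of f] c by (simp add: sums_iff)
    qed
    then show ?thesis by blast
  qed
  then show ?thesis by metis
qed

locale compact_operator =
  fixes A :: "h2 \<Rightarrow> h2"
  assumes compact_op: "compact_op A"
begin

lemma linear: "clinear_h2 A"
  using compact_op by (simp add: compact_op_def)

lemmas lin = clinear_h2D[OF linear]

lemma bounded: "\<exists>K\<ge>0. \<forall>f. norm (A f) \<le> K * norm f"
proof -
  have "bounded (A ` cball 0 1)"
    using compact_op compact_imp_bounded bounded_subset closure_subset unfolding compact_op_def by blast
  then obtain K where "\<forall>g\<in>A ` cball 0 1. norm g \<le> K" unfolding bounded_iff by blast
  then have K: "norm (A f) \<le> K" if "norm f \<le> 1" for f using that by auto
  have "norm (A f) \<le> K * norm f" for f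
  proof (cases "f = 0")
    case False
    have "norm (A (scaleC_h2 (of_real (1 / norm f)) f)) \<le> K"
      using False by (intro K) (simp add: norm_scaleC norm_divide)
    then show ?thesis using False by (simp add: lin norm_scaleC norm_divide field_simps)
  qed (simp add: lin)
  moreover have "0 \<le> K" using K[of 0] by (simp add: lin)
  ultimately show ?thesis by blast
qed

definition K :: real where "K = (SOME K. K \<ge> 0 \<and> (\<forall>f. norm (A f) \<le> K * norm f))"

lemma K: "0 \<le> K" "norm (A f) \<le> K * norm f"
  using someI_ex[OF bounded[unfolded Bex_def]] unfolding K_def by auto

abbreviation "S \<equiv> cadjoint_h2 A"
abbreviation "P f \<equiv> cadjoint_h2 A (A f)"

lemma adjoint: "cinner_h2 (A f) g = cinner_h2 f (S g)"
proof -
  obtain S' where S': "\<forall>f g. cinner_h2 (A f) g = cinner_h2 f (S' g)"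
    using adjoint_exists[OF linear K(2)] by blast
  have "S = S'"
    unfolding cadjoint_h2_def
  proof (rule the_equality)
    fix S'' assume "\<forall>f g. cinner_h2 (A f) g = cinner_h2 f (S'' g)"
    then show "S'' = S'" using S' by (intro ext h2_eqI) simp
  qed (rule S')
  then show ?thesis using S' by simp
qed

lemma adjoint_lin: "S (f + g) = S f + S g" "S (f - g) = S f - S g" "S (scaleC_h2 c f) = scaleC_h2 c (S f)"
  by (rule h2_eqI, simp add: adjoint[symmetric] cinner_add_right cinner_diff_right cinner_scaleC_right)+

lemma P_lin: "P (f + g) = P f + P g" "P (f - g) = P f - P g" "P (scaleC_h2 c f) = scaleC_h2 c (P f)" "P 0 = 0"
  using adjoint_lin(2)[of 0 0] by (simp_all add: lin adjoint_lin)

lemma P_sum: "P (\<Sum>i\<in>I. h i) = (\<Sum>i\<in>I. P (h i))"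
  by (induction I rule: infinite_finite_induct) (simp_all add: P_lin)

lemma cinner_P: "cinner_h2 (P f) g = cinner_h2 (A f) (A g)" "cinner_h2 f (P g) = cinner_h2 (A f) (A g)"
  by (metis adjoint cinner_commute)+

lemma norm_adjoint_le: "norm (S f) \<le> K * norm f"
proof -
  have "(norm (S f))\<^sup>2 = norm (cinner_h2 (A (S f)) f)"
    by (simp add: adjoint cinner_self norm_power)
  also have "\<dots> \<le> norm (A (S f)) * norm f" by (rule norm_cinner_le)
  also have "\<dots> \<le> K * norm (S f) * norm f" by (intro mult_right_mono K) simp
  finally show ?thesis
    using square_le_imp_le[of "norm (S f)" "K * norm f"] K(1) by (simp add: power2_eq_square mult_ac)
qed

lemma bounded_linear_A: "bounded_linear A"
proof (rule bounded_linear_intro[where K = K])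
  show "norm (A f) \<le> norm f * K" for f using K(2)[of f] by (simp only: mult.commute)
qed (simp_all add: lin scaleR_eq_scaleC)

lemma bounded_linear_S: "bounded_linear S"
proof (rule bounded_linear_intro[where K = K])
  show "norm (S f) \<le> norm f * K" for f using norm_adjoint_le[of f] by (simp only: mult.commute)
qed (simp_all add: adjoint_lin scaleR_eq_scaleC)

lemmas tendsto_A = bounded_linear.tendsto[OF bounded_linear_A]
lemmas tendsto_S = bounded_linear.tendsto[OF bounded_linear_S]

lemma norm_A_square: "of_real ((norm (A f))\<^sup>2) = cinner_h2 (P f) f"
  by (simp add: cinner_P cinner_self)

text \<open>The eigenspace of \<open>A\<^sup>* A\<close> for \<open>t\<^sup>2\<close>, so that \<open>t\<close> itself is the singular value.\<close>

definition singular_space :: "real \<Rightarrow> h2 set" where "singular_space t = {f. P f = scaleC_h2 (of_real (t\<^sup>2)) f}"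

lemma singular_spaceD: "f \<in> singular_space t \<Longrightarrow> P f = scaleC_h2 (of_real (t\<^sup>2)) f"
  by (simp add: singular_space_def)

lemma subspace_singular_space: "complex_h2.subspace (singular_space t)"
  unfolding complex_h2.subspace_def singular_space_def
  by (auto simp: P_lin complex_h2.scale_right_distrib mult.commute)

lemma norm_A_singular_space: "f \<in> singular_space t \<Longrightarrow> norm (A f) = \<bar>t\<bar> * norm f"
proof -
  assume "f \<in> singular_space t"
  then have "complex_of_real ((norm (A f))\<^sup>2) = of_real ((\<bar>t\<bar> * norm f)\<^sup>2)"
    unfolding norm_A_square by (simp add: singular_spaceD cinner_scaleC_left cinner_self power_mult_distrib)
  then have "(norm (A f))\<^sup>2 = (\<bar>t\<bar> * norm f)\<^sup>2" unfolding of_real_eq_iff .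
  then show ?thesis by (rule power2_eq_imp_eq) simp_all
qed

lemma singular_space_orthogonal:
  assumes "f \<in> singular_space t" "g \<in> singular_space u" "t > 0" "u > 0" "t \<noteq> u"
  shows "cinner_h2 f g = 0"
proof -
  have "of_real (t\<^sup>2) * cinner_h2 f g = of_real (u\<^sup>2) * cinner_h2 f g"
    using cinner_P[of f g] assms by (simp add: singular_spaceD cinner_scaleC_left cinner_scaleC_right)
  moreover have "complex_of_real (t\<^sup>2) \<noteq> of_real (u\<^sup>2)" unfolding of_real_eq_iff using assms by simp
  ultimately show ?thesis by simp
qed

text \<open>The variational principle. On the orthogonal complement \<open>M\<close> of a set of eigenvectors, which is invariant
under \<open>P = A\<^sup>* A\<close>, the supremum \<open>u\<close> of \<open>\<parallel>A f\<parallel>\<close> over unit vectors is attained at an eigenvector. For a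
maximizing sequence \<open>F n\<close> one has \<open>\<parallel>P F\<^sub>n - u\<^sup>2 F\<^sub>n\<parallel>\<^sup>2 \<le> u\<^sup>2 (u\<^sup>2 - \<parallel>A F\<^sub>n\<parallel>\<^sup>2) \<rightarrow> 0\<close>; compactness makes \<open>A F\<^sub>n\<close>
converge to some \<open>h\<close> along a subsequence, and then \<open>F\<^sub>n\<close> itself converges to \<open>A\<^sup>* h / u\<^sup>2\<close>.\<close>

lemma eigenvector_in_complement:
  assumes Z: "\<And>z. z \<in> Z \<Longrightarrow> \<exists>t. z \<in> singular_space t"
    and f0: "\<And>z. z \<in> Z \<Longrightarrow> cinner_h2 f0 z = 0" "f0 \<noteq> 0" and t: "t > 0" "t * norm f0 \<le> norm (A f0)"
  obtains g u where "u \<ge> t" "g \<noteq> 0" "g \<in> singular_space u" "\<And>z. z \<in> Z \<Longrightarrow> cinner_h2 g z = 0"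
proof -
  define M where "M = {f. \<forall>z\<in>Z. cinner_h2 f z = 0}"
  have M_scale: "scaleC_h2 c f \<in> M" if "f \<in> M" for c f
    using that by (simp add: M_def cinner_scaleC_left)
  have M_P: "P f \<in> M" if "f \<in> M" for f
    unfolding M_def
  proof safe
    fix z assume z: "z \<in> Z"
    then obtain t where "z \<in> singular_space t" using Z by blast
    then have "cinner_h2 (P f) z = of_real (t\<^sup>2) * cinner_h2 f z"
      using cinner_P[of f z] by (simp add: singular_spaceD cinner_scaleC_right)
    then show "cinner_h2 (P f) z = 0" using that z by (simp add: M_def)
  qed
  define V where "V = (\<lambda>f. norm (A f)) ` (M \<inter> cball 0 1)"
  define u where "u = Sup V"
  have bdd: "bdd_above V"
  proof (rule bdd_aboveI)
    fix v assume "v \<in> V"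
    then obtain f where "norm f \<le> 1" "v = norm (A f)" by (auto simp: V_def dist_norm)
    then show "v \<le> K" using K(2)[of f] mult_left_mono[of "norm f" 1 K] K(1) by simp
  qed
  have le_u: "norm (A f) \<le> u * norm f" if f: "f \<in> M" for f
  proof (cases "f = 0")
    case False
    have "norm (A (scaleC_h2 (of_real (1 / norm f)) f)) \<in> V"
      unfolding V_def using False f by (intro imageI) (simp add: M_scale norm_scaleC norm_divide)
    then have "norm (A (scaleC_h2 (of_real (1 / norm f)) f)) \<le> u"
      unfolding u_def by (rule cSup_upper[OF _ bdd])
    then show ?thesis using False by (simp add: lin norm_scaleC norm_divide field_simps)
  qed (simp add: lin)
  have "f0 \<in> M" using f0 by (simp add: M_def)
  then have "t * norm f0 \<le> u * norm f0" using t le_u by (meson order.trans)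
  then have tu: "t \<le> u" using f0(2) by simp
  have "0 \<in> M" by (simp add: M_def)
  then have ne: "V \<noteq> {}" unfolding V_def by auto
  have "\<exists>f. f \<in> M \<and> norm f \<le> 1 \<and> u - 1 / Suc n < norm (A f)" for n
  proof -
    have "u - 1 / Suc n < Sup V" by (simp add: u_def)
    then obtain v where "v \<in> V" "u - 1 / Suc n < v" using less_cSup_iff[OF ne bdd] by blast
    then show ?thesis by (auto simp: V_def)
  qed
  then obtain F where F: "\<And>n. F n \<in> M" "\<And>n. norm (F n) \<le> 1" "\<And>n. u - 1 / Suc n < norm (A (F n))"
    by metis
  have AF_le: "norm (A (F n)) \<le> u" for n
    using le_u[OF F(1)[of n]] mult_left_le[OF F(2)[of n], of u] tu t by linarith
  have "seq_compact (closure (A ` cball 0 1))"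
    using compact_op unfolding compact_op_def by (simp add: compact_imp_seq_compact)
  moreover have "A (F n) \<in> closure (A ` cball 0 1)" for n
    using F(2) closure_subset by (force simp: dist_norm)
  ultimately obtain h r where r: "strict_mono r" and h: "(\<lambda>n. A (F (r n))) \<longlonglongrightarrow> h"
    using seq_compactE[of "closure (A ` cball 0 1)" "\<lambda>n. A (F n)"] unfolding o_def by metis
  have lim_u: "(\<lambda>n. norm (A (F n))) \<longlonglongrightarrow> u"
  proof (rule tendsto_sandwich)
    show "(\<lambda>n. u - 1 / Suc n) \<longlonglongrightarrow> u" by real_asymp
    show "(\<lambda>n. u) \<longlonglongrightarrow> u" by simp
  qed (use F(3) AF_le in \<open>auto intro!: always_eventually less_imp_le\<close>)
  have residual: "(norm (P (F n) - scaleC_h2 (of_real (u\<^sup>2)) (F n)))\<^sup>2 \<le> u\<^sup>2 * (u\<^sup>2 - (norm (A (F n)))\<^sup>2)" for n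
  proof -
    let ?f = "F n"
    have "(norm (P ?f))\<^sup>2 = norm (cinner_h2 (A (P ?f)) (A ?f))"
      unfolding cinner_P(2)[of "P ?f" ?f, symmetric] cinner_self by (simp del: of_real_power)
    also have "\<dots> \<le> norm (A (P ?f)) * norm (A ?f)" by (rule norm_cinner_le)
    also have "\<dots> \<le> u * norm (P ?f) * norm (A ?f)" by (intro mult_right_mono le_u M_P F) simp
    finally have "norm (P ?f) \<le> u * norm (A ?f)"
      using square_le_imp_le[of "norm (P ?f)" "u * norm (A ?f)"] tu t
      by (simp add: power2_eq_square mult_ac)
    then have 1: "(norm (P ?f))\<^sup>2 \<le> u\<^sup>2 * (norm (A ?f))\<^sup>2"
      unfolding power_mult_distrib[symmetric] by (rule power_mono) simp
    have "(norm ?f)\<^sup>2 \<le> 1" using F(2)[of n] by (simp add: power_le_one)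
    then have 2: "u\<^sup>2 * u\<^sup>2 * (norm ?f)\<^sup>2 \<le> u\<^sup>2 * u\<^sup>2" by (simp add: mult_left_le)
    have "P ?f \<bullet> scaleC_h2 (of_real (u\<^sup>2)) ?f = u\<^sup>2 * (norm (A ?f))\<^sup>2"
      unfolding Re_cinner[symmetric] cinner_scaleC_right norm_A_square[symmetric] by simp
    moreover have "(norm (v - w))\<^sup>2 = (norm v)\<^sup>2 + (norm w)\<^sup>2 - 2 * (v \<bullet> w)" for v w :: h2
      by (simp add: power2_norm_eq_inner inner_diff_left inner_diff_right inner_commute)
    moreover have "(norm (scaleC_h2 (of_real (u\<^sup>2)) ?f))\<^sup>2 = u\<^sup>2 * u\<^sup>2 * (norm ?f)\<^sup>2"
      by (simp add: norm_scaleC power2_eq_square norm_mult mult_ac)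
    ultimately have "(norm (P ?f - scaleC_h2 (of_real (u\<^sup>2)) ?f))\<^sup>2 =
        (norm (P ?f))\<^sup>2 + u\<^sup>2 * u\<^sup>2 * (norm ?f)\<^sup>2 - 2 * (u\<^sup>2 * (norm (A ?f))\<^sup>2)"
      by (simp only:)
    then show ?thesis using 1 2 by (simp add: algebra_simps)
  qed
  have "(\<lambda>n. u\<^sup>2 * (u\<^sup>2 - (norm (A (F n)))\<^sup>2)) \<longlonglongrightarrow> u\<^sup>2 * (u\<^sup>2 - u\<^sup>2)"
    by (rule tendsto_mult[OF tendsto_const tendsto_diff[OF tendsto_const tendsto_power[OF lim_u]]])
  then have lim_0: "(\<lambda>n. u\<^sup>2 * (u\<^sup>2 - (norm (A (F n)))\<^sup>2)) \<longlonglongrightarrow> 0" by simp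
  have "(\<lambda>n. (norm (P (F n) - scaleC_h2 (of_real (u\<^sup>2)) (F n)))\<^sup>2) \<longlonglongrightarrow> 0"
  proof (rule tendsto_sandwich[OF _ _ tendsto_const lim_0])
    show "\<forall>\<^sub>F n in sequentially. (norm (P (F n) - scaleC_h2 (of_real (u\<^sup>2)) (F n)))\<^sup>2
        \<le> u\<^sup>2 * (u\<^sup>2 - (norm (A (F n)))\<^sup>2)"
      by (rule always_eventually) (intro allI residual)
  qed (rule always_eventually, simp)
  then have "(\<lambda>n. sqrt ((norm (P (F n) - scaleC_h2 (of_real (u\<^sup>2)) (F n)))\<^sup>2)) \<longlonglongrightarrow> sqrt 0"
    by (rule tendsto_real_sqrt)
  then have "(\<lambda>n. P (F n) - scaleC_h2 (of_real (u\<^sup>2)) (F n)) \<longlonglongrightarrow> 0"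
    by (simp add: tendsto_norm_zero_iff)
  from tendsto_diff[OF tendsto_S[OF h] LIMSEQ_subseq_LIMSEQ[OF this r]]
  have "(\<lambda>n. scaleC_h2 (of_real (u\<^sup>2)) (F (r n))) \<longlonglongrightarrow> S h" by (simp add: o_def)
  from tendsto_scaleC[OF this, of "of_real (1 / u\<^sup>2)"]
  have lim: "(\<lambda>n. F (r n)) \<longlonglongrightarrow> scaleC_h2 (of_real (1 / u\<^sup>2)) (S h)" (is "_ \<longlonglongrightarrow> ?g")
    using tu t by simp
  have Ag: "A ?g = h" by (rule LIMSEQ_unique[OF tendsto_A[OF lim] h])
  have "norm h = u"
    using LIMSEQ_unique[OF tendsto_norm[OF h]] LIMSEQ_subseq_LIMSEQ[OF lim_u r] by (simp add: o_def)
  then have g_ne: "?g \<noteq> 0" using Ag tu t by (auto simp: lin)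
  have g_P: "P ?g = scaleC_h2 (of_real (u\<^sup>2)) ?g" unfolding Ag using tu t by simp
  have g_Z: "cinner_h2 ?g z = 0" if "z \<in> Z" for z
  proof (rule LIMSEQ_unique)
    show "(\<lambda>n. cinner_h2 (F (r n)) z) \<longlonglongrightarrow> cinner_h2 ?g z"
      by (rule bounded_linear.tendsto[OF bounded_linear_cinner lim])
    show "(\<lambda>n. cinner_h2 (F (r n)) z) \<longlonglongrightarrow> 0" using F(1) that by (simp add: M_def)
  qed
  show ?thesis
    by (rule that[OF tu g_ne _ g_Z]) (simp_all only: singular_space_def mem_Collect_eq g_P)
qed

end

section \<open>Singular values and domination\<close>

definition orthonormal :: "h2 set \<Rightarrow> bool" where
  "orthonormal X \<longleftrightarrow> (\<forall>x\<in>X. \<forall>y\<in>X. cinner_h2 x y = (if x = y then 1 else 0))"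

lemma orthonormalD:
  "orthonormal X \<Longrightarrow> x \<in> X \<Longrightarrow> y \<in> X \<Longrightarrow> cinner_h2 x y = (if x = y then 1 else 0)"
  by (simp add: orthonormal_def)

lemma orthonormal_norm:
  assumes "orthonormal X" "x \<in> X"
  shows "norm x = 1"
proof -
  have "complex_of_real ((norm x)\<^sup>2) = of_real (1\<^sup>2)"
    unfolding cinner_self[symmetric] using orthonormalD[OF assms assms(2)] by simp
  then have "(norm x)\<^sup>2 = 1\<^sup>2" unfolding of_real_eq_iff .
  then show ?thesis by (rule power2_eq_imp_eq) simp_all
qed

lemma cinner_orthonormal_combination:
  assumes "orthonormal X" "finite Y" "Y \<subseteq> X" "x \<in> X"
  shows "cinner_h2 (\<Sum>y\<in>Y. scaleC_h2 (c y) y) x = (if x \<in> Y then c x else 0)"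
proof -
  have "cinner_h2 (\<Sum>y\<in>Y. scaleC_h2 (c y) y) x = (\<Sum>y\<in>Y. if y = x then c x else 0)"
    unfolding cinner_sum_left cinner_scaleC_left
    using assms by (intro sum.cong) (auto simp: orthonormalD[OF assms(1)])
  then show ?thesis using assms(2) by simp
qed

lemma orthonormal_independent:
  assumes X: "orthonormal X"
  shows "\<not> complex_h2.dependent X"
  unfolding complex_h2.independent_explicit_module
proof (intro allI impI)
  fix Y u x assume *: "finite Y" "Y \<subseteq> X" "(\<Sum>v\<in>Y. scaleC_h2 (u v) v) = 0" "x \<in> Y"
  then show "u x = 0"
    using cinner_orthonormal_combination[OF X *(1,2), of x u] by auto
qed

lemma cinner_span_eq_0:
  assumes "f \<in> complex_h2.span X" "\<And>x. x \<in> X \<Longrightarrow> cinner_h2 g x = 0"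
  shows "cinner_h2 g f = 0"
  using assms(1)
  by (induction rule: complex_h2.span_induct_alt)
    (simp_all add: cinner_add_right cinner_scaleC_right assms(2))

text \<open>An orthonormal set of maximal size spans: otherwise a vector outside the span, minus its projection,
could be normalized and added.\<close>

lemma orthonormal_basis_exists:
  assumes V: "complex_h2.subspace V"
    and bound: "\<And>X. finite X \<Longrightarrow> orthonormal X \<Longrightarrow> X \<subseteq> V \<Longrightarrow> card X \<le> N"
  shows "\<exists>X. finite X \<and> orthonormal X \<and> X \<subseteq> V \<and> V \<subseteq> complex_h2.span X"
proof -
  define Q where "Q n \<longleftrightarrow> (\<exists>X. finite X \<and> orthonormal X \<and> X \<subseteq> V \<and> card X = n)" for n
  have "Q 0" unfolding Q_def by (intro exI[of _ "{}"]) (simp add: orthonormal_def)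
  moreover have "\<forall>n. Q n \<longrightarrow> n \<le> N" unfolding Q_def using bound by blast
  ultimately obtain n where n: "Q n" "\<And>m. Q m \<Longrightarrow> m \<le> n"
    using ex_has_greatest_nat[of Q 0 "\<lambda>n. n" "Suc N"] by (auto simp: less_Suc_eq_le)
  then obtain X where X: "finite X" "orthonormal X" "X \<subseteq> V" "card X = n" unfolding Q_def by blast
  have "f \<in> complex_h2.span X" if f: "f \<in> V" for f
  proof (rule ccontr)
    assume nin: "f \<notin> complex_h2.span X"
    define p where "p = (\<Sum>x\<in>X. scaleC_h2 (cinner_h2 f x) x)"
    have p: "p \<in> complex_h2.span X"
      unfolding p_def by (intro complex_h2.span_sum complex_h2.span_scale complex_h2.span_base)
    have pV: "p \<in> V"
      unfolding p_def using X V by (intro complex_h2.subspace_sum complex_h2.subspace_scale) auto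
    have ne: "f - p \<noteq> 0" using nin p by auto
    define y where "y = scaleC_h2 (of_real (1 / norm (f - p))) (f - p)"
    have yV: "y \<in> V"
      unfolding y_def using V f pV by (intro complex_h2.subspace_scale complex_h2.subspace_diff)
    have y_orth: "cinner_h2 y x = 0" if "x \<in> X" for x
      using cinner_orthonormal_combination[OF X(2,1) subset_refl that, of "cinner_h2 f"] that
      by (simp add: y_def p_def cinner_scaleC_left cinner_diff_left)
    have "norm y = 1" using ne by (simp add: y_def norm_scaleC norm_divide)
    then have yy: "cinner_h2 y y = 1" by (simp add: cinner_self)
    then have "y \<notin> X" using y_orth by force
    moreover have "orthonormal (insert y X)"
      unfolding orthonormal_def
    proof (intro ballI)
      fix v w assume "v \<in> insert y X" "w \<in> insert y X"
      moreover have "cinner_h2 x y = 0" if "x \<in> X" for x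
        using y_orth[OF that] cinner_commute[of x y] by simp
      ultimately show "cinner_h2 v w = (if v = w then 1 else 0)"
        using y_orth yy orthonormalD[OF X(2)] \<open>y \<notin> X\<close> by (elim insertE) auto
    qed
    ultimately have "Q (Suc n)"
      unfolding Q_def using X yV by (intro exI[of _ "insert y X"]) simp
    then show False using n(2) by fastforce
  qed
  then show ?thesis using X by blast
qed

text \<open>Fewer equations than unknowns: the vectors \<open>L y\<close>, which collect the equations on \<open>y\<close>, lie in a space of
dimension \<open>card X\<close>. If \<open>L\<close> is injective on \<open>Y\<close> their images are linearly dependent; otherwise two of them
coincide.\<close>

lemma underdetermined_system:
  fixes m :: "h2 \<Rightarrow> h2 \<Rightarrow> complex"
  assumes X: "finite X" "orthonormal X" and Y: "finite Y" "card X < card Y"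
  obtains c where "\<exists>y\<in>Y. c y \<noteq> 0" "\<And>x. x \<in> X \<Longrightarrow> (\<Sum>y\<in>Y. c y * m y x) = 0"
proof -
  define L where "L y = (\<Sum>x\<in>X. scaleC_h2 (m y x) x)" for y
  have L: "cinner_h2 (L y) x = m y x" if "x \<in> X" for x y
    using cinner_orthonormal_combination[OF X(2,1) subset_refl that, of "m y"] that by (simp add: L_def)
  have "\<exists>c. (\<exists>y\<in>Y. c y \<noteq> 0) \<and> (\<Sum>y\<in>Y. scaleC_h2 (c y) (L y)) = 0"
  proof (cases "inj_on L Y")
    case True
    have "L y \<in> complex_h2.span X" for y
      unfolding L_def by (intro complex_h2.span_sum complex_h2.span_scale complex_h2.span_base)
    then have "L ` Y \<subseteq> complex_h2.span X" by blast
    moreover have "card (L ` Y) = card Y" by (rule card_image[OF True])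
    ultimately have "complex_h2.dependent (L ` Y)"
      using complex_h2.independent_span_bound[OF X(1), of "L ` Y"] Y by auto
    then obtain u where u: "\<exists>v\<in>L ` Y. u v \<noteq> 0" "(\<Sum>v\<in>L ` Y. scaleC_h2 (u v) v) = 0"
      using complex_h2.dependent_finite[of "L ` Y"] Y(1) by auto
    then show ?thesis using sum.reindex[OF True, of "\<lambda>v. scaleC_h2 (u v) v"]
      by (intro exI[of _ "\<lambda>y. u (L y)"]) auto
  next
    case False
    then obtain y z where yz: "y \<in> Y" "z \<in> Y" "y \<noteq> z" "L y = L z" unfolding inj_on_def by blast
    define c where "c w = (if w = y then 1 else if w = z then -1 else 0 :: complex)" for w
    have "(\<Sum>w\<in>Y. scaleC_h2 (c w) (L w)) = (\<Sum>w\<in>{y, z}. scaleC_h2 (c w) (L w))"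
      using yz Y(1) by (intro sum.mono_neutral_right) (auto simp: c_def)
    also have "\<dots> = 0" using yz by (simp add: c_def)
    finally show ?thesis using yz(1) by (intro exI[of _ c]) (auto simp: c_def)
  qed
  then obtain c where c: "\<exists>y\<in>Y. c y \<noteq> 0" "(\<Sum>y\<in>Y. scaleC_h2 (c y) (L y)) = 0" by blast
  have "(\<Sum>y\<in>Y. c y * m y x) = 0" if "x \<in> X" for x
  proof -
    have "(\<Sum>y\<in>Y. c y * m y x) = cinner_h2 (\<Sum>y\<in>Y. scaleC_h2 (c y) (L y)) x"
      unfolding cinner_sum_left cinner_scaleC_left by (simp add: L[OF that])
    then show ?thesis using c(2) by simp
  qed
  with c(1) show ?thesis by (rule that)
qed

context compact_operator begin

text \<open>Distinct members of an orthonormal set in this space have images under \<open>A\<close> at distance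
\<open>t \<cdot> sqrt 2\<close>, so at most one of them lies in each of the finitely many balls of radius \<open>t/2\<close> that cover
the compact closure of the image of the unit ball.\<close>

lemma singular_space_orthonormal_bound:
  assumes t: "t > 0"
  shows "\<exists>N. \<forall>X. finite X \<and> orthonormal X \<and> X \<subseteq> singular_space t \<longrightarrow> card X \<le> N"
proof -
  let ?C = "closure (A ` cball 0 1)"
  have "seq_compact ?C" using compact_op unfolding compact_op_def by (simp add: compact_imp_seq_compact)
  from seq_compact_imp_totally_bounded[OF this] obtain k where
    k: "finite k" "?C \<subseteq> (\<Union>x\<in>k. ball x (t / 2))" using t by (meson half_gt_zero)
  have "card X \<le> card k" if X: "finite X" "orthonormal X" "X \<subseteq> singular_space t" for X
  proof -
    note x1 = orthonormal_norm[OF X(2)]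
    have "\<exists>z\<in>k. A x \<in> ball z (t / 2)" if "x \<in> X" for x
    proof -
      have "A x \<in> A ` cball 0 1" using x1[OF that] by (intro imageI) simp
      then have "A x \<in> ?C" by (rule subsetD[OF closure_subset])
      then have "A x \<in> (\<Union>x\<in>k. ball x (t / 2))" by (rule subsetD[OF k(2)])
      then show ?thesis by (simp only: UN_iff)
    qed
    then obtain z where z: "\<And>x. x \<in> X \<Longrightarrow> z x \<in> k \<and> dist (z x) (A x) < t / 2"
      unfolding Bex_def mem_ball by metis
    have "inj_on z X"
    proof (rule inj_onI, rule ccontr)
      fix x y assume xy: "x \<in> X" "y \<in> X" "z x = z y" "x \<noteq> y"
      have "x - y \<in> singular_space t" using xy X by (intro complex_h2.subspace_diff[OF subspace_singular_space]) auto
      then have "dist (A x) (A y) = t * norm (x - y)"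
        using t by (simp add: dist_norm norm_A_singular_space flip: lin(4))
      moreover have "complex_of_real ((norm (x - y))\<^sup>2) = of_real 2"
        using xy by (simp add: cinner_self[symmetric] cinner_diff_left cinner_diff_right
            orthonormalD[OF X(2)] del: of_real_power)
      then have "(norm (x - y))\<^sup>2 = 2" unfolding of_real_eq_iff .
      then have "1\<^sup>2 \<le> (norm (x - y))\<^sup>2" by (simp only: one_power2)
      then have "1 \<le> norm (x - y)" by (rule power2_le_imp_le) (rule norm_ge_zero)
      moreover have "dist (A x) (A y) < t"
        using dist_triangle_half_r[of "z x" "A x" t "A y"] z[OF xy(1)] z[OF xy(2)] xy(3) by simp
      ultimately show False using t by simp
    qed
    then show ?thesis using z k(1) by (intro card_inj_on_le[of z]) auto
  qed
  then show ?thesis by blast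
qed

definition singular_basis :: "real \<Rightarrow> h2 set" where
  "singular_basis t = (SOME X. finite X \<and> orthonormal X \<and> X \<subseteq> singular_space t \<and> singular_space t \<subseteq> complex_h2.span X)"

lemma singular_basis_spec:
  assumes "t > 0"
  shows "finite (singular_basis t) \<and> orthonormal (singular_basis t) \<and> singular_basis t \<subseteq> singular_space t \<and> singular_space t \<subseteq> complex_h2.span (singular_basis t)"
proof -
  obtain N where "\<forall>X. finite X \<and> orthonormal X \<and> X \<subseteq> singular_space t \<longrightarrow> card X \<le> N"
    using singular_space_orthonormal_bound[OF assms] by blast
  then have ex: "\<exists>X. finite X \<and> orthonormal X \<and> X \<subseteq> singular_space t \<and> singular_space t \<subseteq> complex_h2.span X"
    by (intro orthonormal_basis_exists[OF subspace_singular_space, of t N]) (simp only: simp_thms)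
  show ?thesis
    unfolding singular_basis_def by (rule someI_ex[OF ex])
qed

lemma finite_singular_basis: "t > 0 \<Longrightarrow> finite (singular_basis t)"
  by (rule singular_basis_spec[THEN conjunct1])

lemma orthonormal_singular_basis: "t > 0 \<Longrightarrow> orthonormal (singular_basis t)"
  by (rule singular_basis_spec[THEN conjunct2, THEN conjunct1])

lemma singular_basis_subset: "t > 0 \<Longrightarrow> singular_basis t \<subseteq> singular_space t"
  by (rule singular_basis_spec[THEN conjunct2, THEN conjunct2, THEN conjunct1])

lemma singular_space_subset_span: "t > 0 \<Longrightarrow> singular_space t \<subseteq> complex_h2.span (singular_basis t)"
  by (rule singular_basis_spec[THEN conjunct2, THEN conjunct2, THEN conjunct2])

lemma dim_singular_space: "t > 0 \<Longrightarrow> complex_h2.dim (singular_space t) = card (singular_basis t)"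
  by (rule complex_h2.dim_unique[OF singular_basis_subset singular_space_subset_span orthonormal_independent[OF orthonormal_singular_basis] refl])

lemma norm_A_singular_basis: "t > 0 \<Longrightarrow> x \<in> singular_basis t \<Longrightarrow> norm (A x) = t"
  using norm_A_singular_space[of x t] singular_basis_subset[of t] orthonormal_norm[OF orthonormal_singular_basis, of t x] by auto

text \<open>An orthonormal basis of the spectral subspace of \<open>A\<^sup>* A\<close> for the singular values \<open>\<ge> t\<close>; its size counts
these singular values with multiplicity.\<close>

definition singular_basis_ge :: "real \<Rightarrow> h2 set" where
  "singular_basis_ge t = (\<Union>u\<in>{t..}. singular_basis u)"

lemma singular_basis_ge_orthonormal:
  assumes t: "t > 0"
  shows "orthonormal (singular_basis_ge t)"
  unfolding orthonormal_def
proof (intro ballI)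
  fix x y assume "x \<in> singular_basis_ge t" "y \<in> singular_basis_ge t"
  then obtain u v where "u \<ge> t" "v \<ge> t" and xy: "x \<in> singular_basis u" "y \<in> singular_basis v"
    by (auto simp: singular_basis_ge_def)
  then have uv: "u > 0" "v > 0" "x \<in> singular_basis u" "y \<in> singular_basis v" using t by auto
  show "cinner_h2 x y = (if x = y then 1 else 0)"
  proof (cases "u = v")
    case True
    then show ?thesis using orthonormalD[OF orthonormal_singular_basis, of u x y] uv by simp
  next
    case False
    then have "cinner_h2 x y = 0" using singular_space_orthogonal[of x u y v] singular_basis_subset uv by blast
    moreover have "x \<noteq> y" using norm_A_singular_basis uv False by metis
    ultimately show ?thesis by simp
  qed
qed

lemma singular_basis_ge_norm_A:
  assumes "t > 0" "x \<in> singular_basis_ge t"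
  shows "t \<le> norm (A x)" "P x = scaleC_h2 (of_real ((norm (A x))\<^sup>2)) x"
proof -
  obtain u where u: "u \<ge> t" "x \<in> singular_basis u" using assms unfolding singular_basis_ge_def by auto
  then have "norm (A x) = u" using assms by (intro norm_A_singular_basis) auto
  then show "t \<le> norm (A x)" "P x = scaleC_h2 (of_real ((norm (A x))\<^sup>2)) x"
    using u singular_basis_subset[of u] assms singular_spaceD by auto
qed

lemma norm_A_combination_ge:
  fixes c :: "h2 \<Rightarrow> complex"
  assumes t: "t > 0" and Y: "finite Y" "Y \<subseteq> singular_basis_ge t"
  defines "f \<equiv> \<Sum>y\<in>Y. scaleC_h2 (c y) y"
  shows "t * norm f \<le> norm (A f)"
proof -
  note orth = singular_basis_ge_orthonormal[OF t]
  have comb: "cinner_h2 (\<Sum>y\<in>Y. scaleC_h2 (d y) y) f = (\<Sum>y\<in>Y. d y * cnj (c y))" for d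
    unfolding f_def cinner_sum_right cinner_scaleC_right
    using Y by (intro sum.cong) (auto simp: cinner_orthonormal_combination[OF orth Y] mult.commute)
  have "complex_of_real ((norm f)\<^sup>2) = of_real (\<Sum>y\<in>Y. (norm (c y))\<^sup>2)"
    unfolding of_real_sum complex_norm_square comb[of c, symmetric] cinner_self[symmetric] by (simp add: f_def)
  then have f: "(norm f)\<^sup>2 = (\<Sum>y\<in>Y. (norm (c y))\<^sup>2)" unfolding of_real_eq_iff .
  have "P f = (\<Sum>y\<in>Y. scaleC_h2 (c y) (P y))" unfolding f_def P_sum by (simp add: P_lin)
  also have "\<dots> = (\<Sum>y\<in>Y. scaleC_h2 (of_real ((norm (A y))\<^sup>2) * c y) y)"
    using Y singular_basis_ge_norm_A(2)[OF t]
    by (intro sum.cong refl) (metis complex_h2.scale_scale mult.commute subsetD)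
  finally have "complex_of_real ((norm (A f))\<^sup>2) = of_real (\<Sum>y\<in>Y. (norm (A y))\<^sup>2 * (norm (c y))\<^sup>2)"
    unfolding norm_A_square of_real_sum of_real_mult complex_norm_square comb by (simp only: comb mult.assoc)
  then have Af: "(norm (A f))\<^sup>2 = (\<Sum>y\<in>Y. (norm (A y))\<^sup>2 * (norm (c y))\<^sup>2)" unfolding of_real_eq_iff .
  have "(t * norm f)\<^sup>2 = (\<Sum>y\<in>Y. t\<^sup>2 * (norm (c y))\<^sup>2)"
    by (simp add: power_mult_distrib f sum_distrib_left)
  also have "\<dots> \<le> (norm (A f))\<^sup>2"
    unfolding Af using Y singular_basis_ge_norm_A(1)[OF t] t
    by (intro sum_mono mult_right_mono power_mono) auto
  finally show ?thesis by (rule power2_le_imp_le) simp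
qed

text \<open>Otherwise the variational principle would give an eigenvector with singular value \<open>\<ge> t\<close> that is
orthogonal to a basis of its own eigenspace.\<close>

lemma norm_A_lt_on_complement:
  assumes t: "t > 0" and f: "f \<noteq> 0" "\<And>x. x \<in> singular_basis_ge t \<Longrightarrow> cinner_h2 f x = 0"
  shows "norm (A f) < t * norm f"
proof (rule ccontr)
  assume "\<not> norm (A f) < t * norm f"
  then have ge: "t * norm f \<le> norm (A f)" by simp
  have ex: "\<exists>u. x \<in> singular_space u" if "x \<in> singular_basis_ge t" for x
    using singular_basis_ge_norm_A(2)[OF t that] unfolding singular_space_def by blast
  show False
  proof (rule eigenvector_in_complement[OF ex f(2) f(1) t ge])
    fix g u
    assume g: "u \<ge> t" "g \<noteq> 0" "g \<in> singular_space u" "\<And>x. x \<in> singular_basis_ge t \<Longrightarrow> cinner_h2 g x = 0"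
    have u: "u > 0" using t g(1) by simp
    have "g \<in> complex_h2.span (singular_basis u)" by (rule subsetD[OF singular_space_subset_span[OF u] g(3)])
    moreover have sub: "singular_basis u \<subseteq> singular_basis_ge t" using g(1) unfolding singular_basis_ge_def by auto
    ultimately have "cinner_h2 g g = 0"
      by (intro cinner_span_eq_0[of g "singular_basis u" g] g(4) subsetD[OF sub])
    then show False using g(2) by (simp add: cinner_self)
  qed
qed

lemma card_singular_basis_ge:
  assumes \<sigma>: "singular_value_sequence A \<sigma>" and lim: "\<sigma> \<longlonglongrightarrow> 0" and t: "t > 0"
  shows "finite {n. \<sigma> n \<ge> t}" "finite (singular_basis_ge t)" "card (singular_basis_ge t) = card {n. \<sigma> n \<ge> t}"
proof -
  have \<sigma>': "finite {n. \<sigma> n = u}" "card {n. \<sigma> n = u} = card (singular_basis u)" if "u > 0" for u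
    using \<sigma> that dim_singular_space[OF that] unfolding singular_value_sequence_def singular_space_def by auto
  have "\<forall>\<^sub>F n in sequentially. \<sigma> n < t" by (rule order_tendstoD(2)[OF lim t])
  then obtain N where N: "\<And>n. n \<ge> N \<Longrightarrow> \<sigma> n < t" unfolding eventually_sequentially by blast
  have "{n. \<sigma> n \<ge> t} \<subseteq> {..<N}" using N by (force simp: not_less[symmetric])
  then show fin: "finite {n. \<sigma> n \<ge> t}" using finite_subset by blast
  define U where "U = \<sigma> ` {n. \<sigma> n \<ge> t}"
  have U: "finite U" "\<And>u. u \<in> U \<Longrightarrow> u > 0" using fin t by (auto simp: U_def)
  have "singular_basis u = {}" if "u \<ge> t" "u \<notin> U" for u
  proof -
    have "{n. \<sigma> n = u} = {}" using that by (auto simp: U_def)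
    then have "card (singular_basis u) = 0" using \<sigma>'(2)[of u] that t by simp
    then show ?thesis using finite_singular_basis[of u] that t by simp
  qed
  then have eb: "singular_basis_ge t = (\<Union>u\<in>U. singular_basis u)"
    unfolding singular_basis_ge_def by (force simp: U_def)
  show "finite (singular_basis_ge t)" unfolding eb using U finite_singular_basis by auto
  have "card (singular_basis_ge t) = (\<Sum>u\<in>U. card (singular_basis u))"
    unfolding eb
  proof (rule card_UN_disjoint[OF U(1)])
    show "\<forall>u\<in>U. \<forall>v\<in>U. u \<noteq> v \<longrightarrow> singular_basis u \<inter> singular_basis v = {}" using norm_A_singular_basis U(2) by blast
  qed (use finite_singular_basis U in auto)
  also have "\<dots> = (\<Sum>u\<in>U. card {n. \<sigma> n = u})" using \<sigma>' U by simp
  also have "\<dots> = card (\<Union>u\<in>U. {n. \<sigma> n = u})"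
    using \<sigma>' U by (intro card_UN_disjoint[symmetric]) auto
  also have "(\<Union>u\<in>U. {n. \<sigma> n = u}) = {n. \<sigma> n \<ge> t}" by (auto simp: U_def)
  finally show "card (singular_basis_ge t) = card {n. \<sigma> n \<ge> t}" .
qed

end

text \<open>If \<open>B\<close> had more singular values \<open>\<ge> t\<close> than \<open>A\<close>, a dimension count would give \<open>f \<noteq> 0\<close> in the spectral
subspace of \<open>B\<close> that is orthogonal to that of \<open>A\<close>; then \<open>t \<parallel>f\<parallel> \<le> \<parallel>B f\<parallel> \<le> \<parallel>A f\<parallel> < t \<parallel>f\<parallel>\<close>.\<close>

lemma card_singular_basis_ge_mono:
  assumes A: "compact_operator A" and B: "compact_operator B"
    and le: "\<And>f. norm (B f) \<le> norm (A f)" and t: "t > 0"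
    and fin: "finite (compact_operator.singular_basis_ge A t)"
  shows "finite (compact_operator.singular_basis_ge B t)"
    "card (compact_operator.singular_basis_ge B t) \<le> card (compact_operator.singular_basis_ge A t)"
proof -
  interpret A: compact_operator A by (rule A)
  interpret B: compact_operator B by (rule B)
  have "card Y \<le> card (A.singular_basis_ge t)" if Y: "finite Y" "Y \<subseteq> B.singular_basis_ge t" for Y
  proof (rule ccontr)
    assume "\<not> card Y \<le> card (A.singular_basis_ge t)"
    then have "card (A.singular_basis_ge t) < card Y" by simp
    from underdetermined_system[OF fin A.singular_basis_ge_orthonormal[OF t] Y(1) this, of cinner_h2]
    obtain c where c: "\<exists>y\<in>Y. c y \<noteq> 0" "\<And>x. x \<in> A.singular_basis_ge t \<Longrightarrow> (\<Sum>y\<in>Y. c y * cinner_h2 y x) = 0"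
      by blast
    define f where "f = (\<Sum>y\<in>Y. scaleC_h2 (c y) y)"
    obtain y where y: "y \<in> Y" "c y \<noteq> 0" using c(1) by blast
    have "cinner_h2 f y = c y"
      unfolding f_def using cinner_orthonormal_combination[OF B.singular_basis_ge_orthonormal[OF t] Y, of y c] y Y by auto
    then have "f \<noteq> 0" using y by auto
    moreover have "cinner_h2 f x = 0" if "x \<in> A.singular_basis_ge t" for x
      unfolding f_def cinner_sum_left cinner_scaleC_left using c(2)[OF that] .
    ultimately have "norm (A f) < t * norm f" by (rule A.norm_A_lt_on_complement[OF t])
    also have "\<dots> \<le> norm (B f)" unfolding f_def by (rule B.norm_A_combination_ge[OF t Y])
    finally show False using le[of f] by simp
  qed
  then have "finite (B.singular_basis_ge t) \<and> card (B.singular_basis_ge t) \<le> card (A.singular_basis_ge t)"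
    by (intro finite_if_finite_subsets_card_bdd) blast
  then show "finite (B.singular_basis_ge t)" "card (B.singular_basis_ge t) \<le> card (A.singular_basis_ge t)" by auto
qed

text \<open>The positive values of \<open>ev\<close>, which accumulate at most at \<open>0\<close>, are listed in decreasing order, padded with zeros.
The entry with index \<open>n\<close> is the supremum of all \<open>t\<close> that are exceeded or attained by more than \<open>n\<close>
members.\<close>

lemma decreasing_enumeration:
  fixes ev :: "'a \<Rightarrow> real"
  assumes fin: "\<And>t. t > 0 \<Longrightarrow> finite {x \<in> X. ev x \<ge> t}"
  obtains \<sigma> :: "nat \<Rightarrow> real" where "decseq \<sigma>" "\<And>n. 0 \<le> \<sigma> n"
    "\<And>n t. t > 0 \<Longrightarrow> t \<le> \<sigma> n \<longleftrightarrow> n < card {x \<in> X. ev x \<ge> t}"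
    "\<And>t. t > 0 \<Longrightarrow> finite {n. \<sigma> n = t} \<and> card {n. \<sigma> n = t} = card {x \<in> X. ev x = t}"
proof -
  define N where "N t = card {x \<in> X. ev x \<ge> t}" for t
  define W where "W n = insert 0 {t. t > 0 \<and> n < N t}" for n
  define \<sigma> where "\<sigma> n = Sup (W n)" for n
  have N_mono: "N t \<le> N s" if "0 < s" "s \<le> t" for s t
    unfolding N_def using that by (intro card_mono fin) auto
  have bdd: "bdd_above (W n)" for n
  proof (rule bdd_aboveI)
    fix t assume t: "t \<in> W n"
    show "t \<le> Max (insert 1 (ev ` {x \<in> X. ev x \<ge> 1}))" (is "_ \<le> ?m")
    proof (rule ccontr)
      assume "\<not> t \<le> ?m"
      then have "?m < t" by simp
      moreover have "finite (insert 1 (ev ` {x \<in> X. ev x \<ge> 1}))" using fin[of 1] by simp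
      ultimately have "\<forall>v\<in>insert 1 (ev ` {x \<in> X. ev x \<ge> 1}). v < t"
        using Max_less_iff by blast
      then have "1 < t" "\<And>x. x \<in> X \<Longrightarrow> ev x \<ge> 1 \<Longrightarrow> ev x < t" by auto
      then have "{x \<in> X. ev x \<ge> t} = {}" by force
      then have "N t = 0" unfolding N_def by (simp only: card.empty)
      then show False using t \<open>1 < t\<close> by (auto simp: W_def)
    qed
  qed
  have ge: "t \<le> \<sigma> n \<longleftrightarrow> n < N t" if t: "t > 0" for n t
  proof
    assume "n < N t"
    then show "t \<le> \<sigma> n" unfolding \<sigma>_def using t by (intro cSup_upper[OF _ bdd]) (simp add: W_def)
  next
    assume le: "t \<le> \<sigma> n"
    show "n < N t"
    proof (rule ccontr)
      assume "\<not> n < N t"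
      \<comment> \<open>choose \<open>s < t\<close> above every value below \<open>t\<close>; then the counts at \<open>s\<close> and \<open>t\<close> agree\<close>
      define F where "F = insert (t / 2) (ev ` {x \<in> X. ev x \<ge> t / 2 \<and> ev x < t})"
      have "finite {x \<in> X. ev x \<ge> t / 2 \<and> ev x < t}"
        using t by (intro finite_subset[OF _ fin[of "t / 2"]]) auto
      then have F: "finite F" "F \<noteq> {}" by (auto simp: F_def)
      have "Max F < t" using Max_in[OF F] t by (auto simp: F_def)
      have "t / 2 \<le> Max F" by (rule Max_ge[OF F(1)]) (simp add: F_def)
      define s where "s = (Max F + t) / 2"
      have s: "Max F < s" "s < t" "t / 2 \<le> s" "0 < s"
        using \<open>Max F < t\<close> \<open>t / 2 \<le> Max F\<close> t by (auto simp: s_def)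
      have "{x \<in> X. ev x \<ge> s} = {x \<in> X. ev x \<ge> t}"
      proof safe
        fix x assume x: "x \<in> X" "s \<le> ev x"
        show "t \<le> ev x"
        proof (rule ccontr)
          assume "\<not> t \<le> ev x"
          then have "ev x \<in> F" using x s by (auto simp: F_def)
          then have "ev x \<le> Max F" using F by simp
          then show False using x s by simp
        qed
      qed (use s in auto)
      then have "N s = N t" by (simp add: N_def)
      have "\<sigma> n \<le> s"
        unfolding \<sigma>_def
      proof (rule cSup_least)
        fix u assume u: "u \<in> W n"
        show "u \<le> s"
        proof (rule ccontr)
          assume "\<not> u \<le> s"
          then have "n < N u" "s \<le> u" using u s by (auto simp: W_def)
          then show False using N_mono[of s u] s \<open>N s = N t\<close> \<open>\<not> n < N t\<close> by simp
        qed
      qed (simp add: W_def)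
      then show False using le s by simp
    qed
  qed
  have nonneg: "0 \<le> \<sigma> n" for n
    unfolding \<sigma>_def by (rule cSup_upper[OF _ bdd]) (simp add: W_def)
  have dec: "decseq \<sigma>"
  proof (rule decseq_SucI)
    fix n show "\<sigma> (Suc n) \<le> \<sigma> n"
      using ge[of "\<sigma> (Suc n)" "Suc n"] ge[of "\<sigma> (Suc n)" n] nonneg[of n] by (cases "\<sigma> (Suc n) > 0") auto
  qed
  have gt: "t < \<sigma> n \<longleftrightarrow> n < card {x \<in> X. ev x > t}" if t: "t > 0" for n t
  proof
    assume less: "t < \<sigma> n"
    then have "n < N (\<sigma> n)" using ge[of "\<sigma> n" n] t by simp
    also have "\<dots> \<le> card {x \<in> X. ev x > t}"
      unfolding N_def using less t by (intro card_mono finite_subset[OF _ fin[OF t]]) auto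
    finally show "n < card {x \<in> X. ev x > t}" .
  next
    assume n: "n < card {x \<in> X. ev x > t}"
    define s where "s = Min (ev ` {x \<in> X. ev x > t})"
    have f: "finite (ev ` {x \<in> X. ev x > t})"
      by (intro finite_imageI finite_subset[OF _ fin[OF t]]) auto
    have "{x \<in> X. ev x > t} \<noteq> {}" using n by force
    then have "s \<in> ev ` {x \<in> X. ev x > t}" unfolding s_def using f by (intro Min_in) auto
    then have "s > t" by auto
    moreover have "{x \<in> X. ev x \<ge> s} = {x \<in> X. ev x > t}"
      using \<open>s > t\<close> f by (auto simp: s_def)
    then have "n < N s" using n by (simp add: N_def)
    ultimately show "t < \<sigma> n" using ge[of s n] t by simp
  qed
  have "finite {n. \<sigma> n = t} \<and> card {n. \<sigma> n = t} = card {x \<in> X. ev x = t}" if t: "t > 0" for t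
  proof -
    have "{n. \<sigma> n = t} = {n. t \<le> \<sigma> n \<and> \<not> t < \<sigma> n}" by auto
    also have "\<dots> = {card {x \<in> X. ev x > t}..<N t}" unfolding ge[OF t] gt[OF t] by auto
    finally have eq: "{n. \<sigma> n = t} = {card {x \<in> X. ev x > t}..<N t}" .
    have "{x \<in> X. ev x \<ge> t} = {x \<in> X. ev x > t} \<union> {x \<in> X. ev x = t}" by auto
    moreover have "finite {x \<in> X. ev x > t}" "finite {x \<in> X. ev x = t}"
      by (auto intro!: finite_subset[OF _ fin[OF t]])
    ultimately have "N t = card {x \<in> X. ev x > t} + card {x \<in> X. ev x = t}"
      unfolding N_def by (simp add: card_Un_disjoint disjoint_iff)
    then show ?thesis unfolding eq by simp
  qed
  with dec nonneg ge show ?thesis unfolding N_def by (rule that)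
qed

text \<open>The singular value sequence of \<open>B\<close> is the decreasing list of the norms \<open>\<parallel>B x\<parallel>\<close> over an orthonormal
eigenbasis; counting the entries \<open>\<ge> t\<close> shows that it lies below that of \<open>A\<close>.\<close>

theorem schatten_dominated:
  assumes A: "A \<in> schatten p" and p: "p > 0" and B: "compact_op B"
    and le: "\<And>f. norm (B f) \<le> norm (A f)"
  shows "B \<in> schatten p"
proof -
  obtain \<sigma> where \<sigma>: "singular_value_sequence A \<sigma>" "summable (\<lambda>n. \<sigma> n powr p)" and cA: "compact_op A"
    using A by (auto simp: schatten_def)
  interpret A: compact_operator A by unfold_locales (rule cA)
  interpret B: compact_operator B by unfold_locales (rule B)
  have \<sigma>0: "0 \<le> \<sigma> n" and dec: "decseq \<sigma>" for n using \<sigma>(1) by (auto simp: singular_value_sequence_def)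
  \<comment> \<open>summability of the \<open>p\<close>-th powers forces the singular values to tend to \<open>0\<close>\<close>
  have "(\<lambda>n. (\<sigma> n powr p) powr (1 / p)) \<longlonglongrightarrow> 0 powr (1 / p)"
    using p by (intro tendsto_powr' summable_LIMSEQ_zero[OF \<sigma>(2)] tendsto_const) auto
  then have lim: "\<sigma> \<longlonglongrightarrow> 0" using p \<sigma>0 by (simp add: powr_powr)
  define X where "X = (\<Union>u\<in>{0<..}. B.singular_basis u)"
  have level: "{x \<in> X. norm (B x) \<ge> t} = B.singular_basis_ge t" if t: "t > 0" for t
  proof
    show "{x \<in> X. norm (B x) \<ge> t} \<subseteq> B.singular_basis_ge t"
      unfolding X_def B.singular_basis_ge_def using B.norm_A_singular_basis by auto
    have "B.singular_basis_ge t \<subseteq> X"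
      unfolding X_def B.singular_basis_ge_def by (rule UN_mono) (use t in auto)
    then show "B.singular_basis_ge t \<subseteq> {x \<in> X. norm (B x) \<ge> t}"
      using B.singular_basis_ge_norm_A(1)[OF t] by auto
  qed
  have level': "{x \<in> X. norm (B x) = t} = B.singular_basis t" if "t > 0" for t
    using that unfolding X_def by (auto simp: B.norm_A_singular_basis)
  have card: "finite (B.singular_basis_ge t)" "card (B.singular_basis_ge t) \<le> card {n. \<sigma> n \<ge> t}" if t: "t > 0" for t
    using card_singular_basis_ge_mono[OF A.compact_operator_axioms B.compact_operator_axioms le t]
      A.card_singular_basis_ge[OF \<sigma>(1) lim t] by auto
  obtain \<tau> where \<tau>: "decseq \<tau>" "\<And>n. 0 \<le> \<tau> n"
    "\<And>n t. t > 0 \<Longrightarrow> t \<le> \<tau> n \<longleftrightarrow> n < card {x \<in> X. norm (B x) \<ge> t}"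
    "\<And>t. t > 0 \<Longrightarrow> finite {n. \<tau> n = t} \<and> card {n. \<tau> n = t} = card {x \<in> X. norm (B x) = t}"
    using decreasing_enumeration[of X "\<lambda>x. norm (B x)"] card(1) level by auto
  have "singular_value_sequence B \<tau>"
    unfolding singular_value_sequence_def
    using \<tau>(1,2,4) by (simp add: level' B.dim_singular_space[symmetric] B.singular_space_def)
  moreover have "\<tau> n \<le> \<sigma> n" for n
  proof (rule ccontr)
    assume "\<not> \<tau> n \<le> \<sigma> n"
    then have less: "\<sigma> n < \<tau> n" by simp
    then have pos: "0 < \<tau> n" using \<sigma>0[of n] by simp
    then have "n < card {m. \<sigma> m \<ge> \<tau> n}"
      using \<tau>(3)[OF pos, of n] level[OF pos] card(2)[OF pos] by simp
    moreover have "{m. \<sigma> m \<ge> \<tau> n} \<subseteq> {..<n}"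
    proof
      fix m assume "m \<in> {m. \<sigma> m \<ge> \<tau> n}"
      then have "\<sigma> n < \<sigma> m" using less by simp
      then have "\<not> n \<le> m" using decseqD[OF dec, of n m] by auto
      then show "m \<in> {..<n}" by simp
    qed
    then have "card {m. \<sigma> m \<ge> \<tau> n} \<le> card {..<n}" by (intro card_mono) simp_all
    ultimately show False by simp
  qed
  then have "summable (\<lambda>n. \<tau> n powr p)"
    using p \<tau>(2) by (intro summable_comparison_test'[OF \<sigma>(2)]) (auto intro: powr_mono2)
  ultimately show ?thesis using B by (auto simp: schatten_def)
qed

lemma compact_op_comp:
  assumes A: "compact_op A" and T: "clinear_h2 T" and le: "\<And>g. norm (T g) \<le> norm g"
  shows "compact_op (\<lambda>f. T (A f))"
  unfolding compact_op_def
proof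
  have linA: "clinear_h2 A" and cA: "compact (closure (A ` cball 0 1))"
    using A by (auto simp: compact_op_def)
  show "clinear_h2 (\<lambda>f. T (A f))"
    by unfold_locales (simp_all add: clinear_h2D[OF linA] clinear_h2D[OF T])
  have "bounded_linear T"
    by (rule bounded_linear_intro[where K = 1]) (simp_all add: clinear_h2D[OF T] scaleR_eq_scaleC le)
  then have "compact (T ` closure (A ` cball 0 1))"
    by (intro compact_continuous_image cA linear_continuous_on)
  then have "compact (T ` closure (A ` cball 0 1) \<inter> closure ((\<lambda>f. T (A f)) ` cball 0 1))"
    by (rule compact_Int_closed) simp
  moreover have "closure ((\<lambda>f. T (A f)) ` cball 0 1) \<subseteq> T ` closure (A ` cball 0 1)"
    using closure_subset[of "A ` cball 0 1"]
    by (intro closure_minimal compact_imp_closed \<open>compact (T ` closure (A ` cball 0 1))\<close>) auto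
  ultimately show "compact (closure ((\<lambda>f. T (A f)) ` cball 0 1))"
    by (simp add: Int_absorb1)
qed

section \<open>Compactness and Schatten classes\<close>

theorem theorem4p2:
  fixes \<phi> R \<phi>\<^sub>D :: "complex \<Rightarrow> complex" and c :: "nat \<Rightarrow> complex" and D :: "complex set"
  assumes phi: "\<phi> \<in> GH0"
    and coeffs: "has_dirichlet_series \<phi> c"
    and D_domain: "open D" "connected D" "simply_connected D"
    and D_sub: "D \<subseteq> half_plane (1/2)"
    and range: "\<phi> ` half_plane 0 \<subseteq> D"
    and riemann: "R holomorphic_on ball 0 1" "inj_on R (ball 0 1)" "R ` ball 0 1 = D"
    and R0: "R 0 = c 1"
    and phi_D: "\<phi>\<^sub>D = (\<lambda>s. R (2 powr (- s)))"
  shows "(compact_op (comp_op \<phi>\<^sub>D) \<longrightarrow> compact_op (comp_op \<phi>)) \<and>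
         (\<forall>p C. 1 \<le> p \<and> 0 < C \<and> (\<forall>s\<in>D. \<bar>Im s\<bar> \<le> C) \<and> comp_op \<phi>\<^sub>D \<in> schatten (2 * p)
            \<longrightarrow> comp_op \<phi> \<in> schatten (2 * p))"
proof -
  have factor: "compact_op (comp_op \<phi>) \<and> (\<forall>f. norm (comp_op \<phi> f) \<le> norm (comp_op \<phi>\<^sub>D f))"
    if "compact_op (comp_op \<phi>\<^sub>D)"
  proof -
    have lin: "clinear_h2 (comp_op (\<lambda>s. R (2 powr (- s))))"
      using that unfolding phi_D compact_op_def by (rule conjunct1)
    show ?thesis
    proof (rule comp_op_factorization[OF phi coeffs D_domain(1) D_sub range riemann R0 lin])
      fix T
      assume T: "clinear_h2 T" "\<And>g. norm (T g) \<le> norm g"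
        and eq: "comp_op \<phi> = (\<lambda>f. T (comp_op (\<lambda>s. R (2 powr (- s))) f))"
      show ?thesis
        unfolding eq phi_D[symmetric] using compact_op_comp[OF that T] T(2) by simp
    qed
  qed
  have "comp_op \<phi> \<in> schatten (2 * p)" if p: "1 \<le> p" and S: "comp_op \<phi>\<^sub>D \<in> schatten (2 * p)" for p
  proof (rule schatten_dominated[OF S])
    have "compact_op (comp_op \<phi>\<^sub>D)" using S by (simp add: schatten_def)
    then have "compact_op (comp_op \<phi>) \<and> (\<forall>f. norm (comp_op \<phi> f) \<le> norm (comp_op \<phi>\<^sub>D f))"
      by (rule factor)
    then show "compact_op (comp_op \<phi>)" "norm (comp_op \<phi> f) \<le> norm (comp_op \<phi>\<^sub>D f)" for f
      by simp_all
  qed (use p in simp)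
  then show ?thesis using factor by simp
qed

end
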